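(* Let $E$ and $F$ be Banach spaces, let $\lambda$ be a scalar sequence space, and let $X$ and $Y$ be linearly stable sequence classes with $X(\mathbb K)\stackrel{1}{\hookrightarrow}\lambda$ and $Y(\mathbb K)\stackrel{1}{\hookrightarrow}\lambda_*$. For $u=\sum_{j=1}^k x_j\otimes y_j\in E\otimes F$, the expression $$\alpha_\lambda(u)=\sup\left\{\left|\sum_{j=1}^k\sum_{n=1}^\infty\varphi_n(x_j)\psi_n(y_j)\right| : (\varphi_n)_{n=1}^\infty\in B_{X(E')},\ (\psi_n)_{n=1}^\infty\in B_{Y(F')}\right\}$$ defines a reasonable crossnorm on $E\otimes F$.
   Context: Banach spaces are over $\mathbb K=\mathbb R$ or $\mathbb C$; $E'$ is the topological dual of $E$ and $B_E$ its closed unit ball (of $E$); $E\stackrel{1}{\hookrightarrow}F$ means $E$ is a linear subspace of $F$ and $\|x\|_F\le\|x\|_E$ for all $x\in E$. For $x\in E$, $x\cdot e_j$ is the sequence with $x$ in the $j$-th coordinate and $0$ elsewhere. A sequence class is a rule $X$ assigning to each Banach space $E$ a Banach space $X(E)$ of $E$-valued sequences (a linear subspace of $E^{\mathbb N}$ with coordinatewise operations) such that $c_{00}(E)\subseteq X(E)\stackrel{1}{\hookrightarrow}\ell_\infty(E)$ and $\|x\cdot e_j\|_{X(E)}=\|x\|_E$ for all $E$, $x\in E$, $j\in\mathbb N$. It is linearly stable if for all Banach spaces $E,F$ and every bounded linear $T\colon E\to F$, one has $(T(x_j))_j\in X(F)$ whenever $(x_j)_j\in X(E)$, and the induced operator $\widehat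 T\colon X(E)\to X(F)$ satisfies $\|\widehat T\|=\|T\|$. A scalar sequence space $\lambda$ is a Banach space of scalar sequences ($\lambda\subseteq\mathbb K^{\mathbb N}$ with coordinatewise operations) such that $c_{00}\subseteq\lambda\stackrel{1}{\hookrightarrow}\ell_\infty$, $(e_j)_{j=1}^\infty$ (the canonical unit vectors) is a Schauder basis of $\lambda$, and $\|e_j\|_\lambda=1$ for all $j$. Put $\lambda_*=\{(\varphi(e_j))_{j=1}^\infty:\varphi\in\lambda'\}$ with norm $\|(\varphi(e_j))_{j=1}^\infty\|_{\lambda_*}=\|\varphi\|$; this is a Banach space isometrically isomorphic to $\lambda'$. A norm $\alpha$ on $E\otimes F$ is a reasonable crossnorm if (i) $\alpha(x\otimes y)\le\|x\|\,\|y\|$ for all $x\in E$, $y\in F$, and (ii) for all $\varphi\in E'$, $\psi\in F'$ the linear functional $\varphi\otimes\psi$ on $(E\otimes F,\alpha)$ is continuous with $\|\varphi\otimes\psi\|\le\|\varphi\|\,\|\psi\|$. *)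

theory Defs
  imports "HOL-Analysis.Analysis" "HOL-Algebra.Module"
begin

section \<open>The scalar field\<close>

text \<open>The two alternatives say that the field is \<open>\<real>\<close>, respectively \<open>\<complex>\<close>, with its usual absolute value.\<close>

class real_or_complex = real_normed_field + banach +
  assumes real_or_complex:
    "(\<forall>z. \<exists>a. z = a *\<^sub>R 1) \<or>
     (\<exists>i. i * i = - 1 \<and>
        (\<forall>z. \<exists>a b. z = a *\<^sub>R 1 + b *\<^sub>R i \<and> norm z = sqrt (a\<^sup>2 + b\<^sup>2)))"

instance real :: real_or_complex
  by standard auto

instance complex :: real_or_complex
proof
  have "\<exists>a b. z = a *\<^sub>R 1 + b *\<^sub>R \<i> \<and> norm z = sqrt (a\<^sup>2 + b\<^sup>2)" for z :: complex
    by (intro exI[of _ "Re z"] exI[of _ "Im z"]) (simp add: complex_eq_iff cmod_def)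
  then show "(\<forall>z::complex. \<exists>a. z = a *\<^sub>R 1) \<or>
     (\<exists>i::complex. i * i = - 1 \<and>
        (\<forall>z. \<exists>a b. z = a *\<^sub>R 1 + b *\<^sub>R i \<and> norm z = sqrt (a\<^sup>2 + b\<^sup>2)))"
    by (intro disjI2 exI[of _ "\<i>"]) simp
qed


section \<open>Normed spaces and Banach spaces with explicit carrier\<close>

text \<open>
  Sequence classes are functions of a Banach space, so Banach spaces are values here and not
  types. As for every \<open>module\<close> of HOL-Algebra, the fields \<open>mult\<close> and \<open>one\<close> inherited from
  \<open>ring\<close> carry no meaning; they are left \<open>undefined\<close>.
\<close>

record ('k, 'a) nspace = "('k, 'a) module" +
  nrm :: "'a \<Rightarrow> real"

definition scalar_space :: "('k::real_or_complex, 'k) nspace" where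
  "scalar_space = \<lparr>carrier = UNIV, mult = (*), one = 1, zero = 0, add = (+), smult = (*), nrm = norm\<rparr>"

definition normed_space :: "('k::real_or_complex, 'a) nspace \<Rightarrow> bool" where
  "normed_space V \<longleftrightarrow>
     Module.module (scalar_space :: ('k, 'k) nspace) V \<and>
     (\<forall>x\<in>carrier V. 0 \<le> nrm V x) \<and>
     (\<forall>x\<in>carrier V. nrm V x = 0 \<longleftrightarrow> x = \<zero>\<^bsub>V\<^esub>) \<and>
     (\<forall>c. \<forall>x\<in>carrier V. nrm V (c \<odot>\<^bsub>V\<^esub> x) = norm c * nrm V x) \<and>
     (\<forall>x\<in>carrier V. \<forall>y\<in>carrier V. nrm V (x \<oplus>\<^bsub>V\<^esub> y) \<le> nrm V x + nrm V y)"

text \<open>The locale \<open>Metric_space\<close> requires symmetry and nonnegativity outside the carrier as well.\<close>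

definition ndist :: "('k, 'a) nspace \<Rightarrow> 'a \<Rightarrow> 'a \<Rightarrow> real" where
  "ndist V x y = (if x \<in> carrier V \<and> y \<in> carrier V then nrm V (x \<ominus>\<^bsub>V\<^esub> y) else 0)"

definition banach_space :: "('k::real_or_complex, 'a) nspace \<Rightarrow> bool" where
  "banach_space V \<longleftrightarrow> normed_space V \<and> Metric_space.mcomplete (carrier V) (ndist V)"

definition unit_ball :: "('k, 'a) nspace \<Rightarrow> 'a set" where
  "unit_ball V = {x \<in> carrier V. nrm V x \<le> 1}"

definition linear_map :: "('k, 'a) nspace \<Rightarrow> ('k, 'b) nspace \<Rightarrow> ('a \<Rightarrow> 'b) \<Rightarrow> bool" where
  "linear_map V W T \<longleftrightarrow>
     (\<forall>x\<in>carrier V. T x \<in> carrier W) \<and>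
     (\<forall>x\<in>carrier V. \<forall>y\<in>carrier V. T (x \<oplus>\<^bsub>V\<^esub> y) = T x \<oplus>\<^bsub>W\<^esub> T y) \<and>
     (\<forall>c. \<forall>x\<in>carrier V. T (c \<odot>\<^bsub>V\<^esub> x) = c \<odot>\<^bsub>W\<^esub> T x)"

definition bounded_linear_map :: "('k, 'a) nspace \<Rightarrow> ('k, 'b) nspace \<Rightarrow> ('a \<Rightarrow> 'b) \<Rightarrow> bool" where
  "bounded_linear_map V W T \<longleftrightarrow>
     linear_map V W T \<and> (\<exists>C. \<forall>x\<in>carrier V. nrm W (T x) \<le> C * nrm V x)"

definition op_norm :: "('k, 'a) nspace \<Rightarrow> ('k, 'b) nspace \<Rightarrow> ('a \<Rightarrow> 'b) \<Rightarrow> real" where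
  "op_norm V W T = (SUP x\<in>unit_ball V. nrm W (T x))"

text \<open>Functionals are extended by 0 outside the carrier, so that equality of functionals is
  equality of HOL functions.\<close>

definition dual :: "('k::real_or_complex, 'a) nspace \<Rightarrow> ('k, 'a \<Rightarrow> 'k) nspace" where
  "dual V =
     \<lparr>carrier = {\<phi>. bounded_linear_map V scalar_space \<phi> \<and> (\<forall>x. x \<notin> carrier V \<longrightarrow> \<phi> x = 0)},
      mult = undefined, one = undefined,
      zero = (\<lambda>x. 0), add = (\<lambda>\<phi> \<psi> x. \<phi> x + \<psi> x), smult = (\<lambda>c \<phi> x. c * \<phi> x),
      nrm = op_norm V scalar_space\<rparr>"

text \<open>\<open>embeds1 V W\<close> is \<open>V \<hookrightarrow> W\<close> with constant 1: linear subspace and norm inequality.\<close>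

definition embeds1 :: "('k, 'a) nspace \<Rightarrow> ('k, 'a) nspace \<Rightarrow> bool" where
  "embeds1 V W \<longleftrightarrow>
     carrier V \<subseteq> carrier W \<and>
     \<zero>\<^bsub>V\<^esub> = \<zero>\<^bsub>W\<^esub> \<and>
     (\<forall>x\<in>carrier V. \<forall>y\<in>carrier V. x \<oplus>\<^bsub>V\<^esub> y = x \<oplus>\<^bsub>W\<^esub> y) \<and>
     (\<forall>c. \<forall>x\<in>carrier V. c \<odot>\<^bsub>V\<^esub> x = c \<odot>\<^bsub>W\<^esub> x) \<and>
     (\<forall>x\<in>carrier V. nrm W x \<le> nrm V x)"


section \<open>Sequence classes\<close>

text \<open>Sequences are indexed by \<open>0, 1, 2, \<dots>\<close>.\<close>

definition sequence_space ::
  "('k, 'a) nspace \<Rightarrow> (nat \<Rightarrow> 'a) set \<Rightarrow> ((nat \<Rightarrow> 'a) \<Rightarrow> real) \<Rightarrow> ('k, nat \<Rightarrow> 'a) nspace" where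
  "sequence_space V S N =
     \<lparr>carrier = S, mult = undefined, one = undefined,
      zero = (\<lambda>n. \<zero>\<^bsub>V\<^esub>), add = (\<lambda>s t n. s n \<oplus>\<^bsub>V\<^esub> t n), smult = (\<lambda>c s n. c \<odot>\<^bsub>V\<^esub> s n),
      nrm = N\<rparr>"

definition linf :: "('k, 'a) nspace \<Rightarrow> ('k, nat \<Rightarrow> 'a) nspace" where
  "linf V = sequence_space V
     {s. (\<forall>n. s n \<in> carrier V) \<and> bdd_above (range (\<lambda>n. nrm V (s n)))}
     (\<lambda>s. SUP n. nrm V (s n))"

definition c00 :: "('k, 'a) nspace \<Rightarrow> (nat \<Rightarrow> 'a) set" where
  "c00 V = {s. (\<forall>n. s n \<in> carrier V) \<and> finite {n. s n \<noteq> \<zero>\<^bsub>V\<^esub>}}"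

definition single :: "('k, 'a) nspace \<Rightarrow> 'a \<Rightarrow> nat \<Rightarrow> nat \<Rightarrow> 'a" where
  "single V x j = (\<lambda>n. if n = j then x else \<zero>\<^bsub>V\<^esub>)"

text \<open>
  A sequence class is a rule on all Banach spaces. HOL has no type of all Banach spaces; the rule
  is therefore defined on all Banach spaces whose carrier is a set of elements of a type \<open>'u\<close>,
  which plays the role of a universe and is an arbitrary type throughout.
\<close>

type_synonym ('k, 'u) seq_rule = "('k, 'u) nspace \<Rightarrow> ('k, nat \<Rightarrow> 'u) nspace"

definition sequence_class :: "('k::real_or_complex, 'u) seq_rule \<Rightarrow> bool" where
  "sequence_class X \<longleftrightarrow>
     (\<forall>V. banach_space V \<longrightarrow>
        banach_space (X V) \<and>
        c00 V \<subseteq> carrier (X V) \<and>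
        embeds1 (X V) (linf V) \<and>
        (\<forall>x\<in>carrier V. \<forall>j. nrm (X V) (single V x j) = nrm V x))"

definition linearly_stable :: "('k::real_or_complex, 'u) seq_rule \<Rightarrow> bool" where
  "linearly_stable X \<longleftrightarrow>
     (\<forall>V W T. banach_space V \<longrightarrow> banach_space W \<longrightarrow> bounded_linear_map V W T \<longrightarrow>
        (\<forall>s\<in>carrier (X V). (\<lambda>n. T (s n)) \<in> carrier (X W)) \<and>
        bounded_linear_map (X V) (X W) (\<lambda>s n. T (s n)) \<and>
        op_norm (X V) (X W) (\<lambda>s n. T (s n)) = op_norm V W T)"

text \<open>
  For a space \<open>V\<close> over another type \<open>'a\<close> and \<open>\<iota> :: 'a \<Rightarrow> 'u\<close> injective on its carrier,
  \<open>copy \<iota> V\<close> is the isometric copy of \<open>V\<close> inside the universe, and \<open>class_at \<iota> X V\<close> is the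
  space \<open>X(V)\<close>: the sequences in \<open>V\<close> whose image under \<open>\<iota>\<close> lies in \<open>X(copy \<iota> V)\<close>, normed
  accordingly.
\<close>

definition copy :: "('a \<Rightarrow> 'u) \<Rightarrow> ('k, 'a) nspace \<Rightarrow> ('k, 'u) nspace" where
  "copy \<iota> V =
     (let \<kappa> = inv_into (carrier V) \<iota> in
      \<lparr>carrier = \<iota> ` carrier V, mult = undefined, one = undefined,
       zero = \<iota> \<zero>\<^bsub>V\<^esub>, add = (\<lambda>u v. \<iota> (\<kappa> u \<oplus>\<^bsub>V\<^esub> \<kappa> v)), smult = (\<lambda>c u. \<iota> (c \<odot>\<^bsub>V\<^esub> \<kappa> u)),
       nrm = (\<lambda>u. nrm V (\<kappa> u))\<rparr>)"

definition class_at ::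
  "('a \<Rightarrow> 'u) \<Rightarrow> ('k, 'u) seq_rule \<Rightarrow> ('k, 'a) nspace \<Rightarrow> ('k, nat \<Rightarrow> 'a) nspace" where
  "class_at \<iota> X V = sequence_space V
     {s. (\<forall>n. s n \<in> carrier V) \<and> (\<lambda>n. \<iota> (s n)) \<in> carrier (X (copy \<iota> V))}
     (\<lambda>s. nrm (X (copy \<iota> V)) (\<lambda>n. \<iota> (s n)))"


section \<open>Scalar sequence spaces\<close>

definition schauder_basis :: "('k, 'a) nspace \<Rightarrow> (nat \<Rightarrow> 'a) \<Rightarrow> bool" where
  "schauder_basis V b \<longleftrightarrow>
     (\<forall>j. b j \<in> carrier V) \<and>
     (\<forall>x\<in>carrier V. \<exists>!a :: nat \<Rightarrow> 'k.
        (\<lambda>n. nrm V (x \<ominus>\<^bsub>V\<^esub> finsum V (\<lambda>j. a j \<odot>\<^bsub>V\<^esub> b j) {..<n})) \<longlonglongrightarrow> 0)"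

abbreviation unit_vec :: "nat \<Rightarrow> nat \<Rightarrow> 'k::real_or_complex" where
  "unit_vec \<equiv> single scalar_space 1"

definition scalar_sequence_space :: "('k::real_or_complex, nat \<Rightarrow> 'k) nspace \<Rightarrow> bool" where
  "scalar_sequence_space \<Lambda> \<longleftrightarrow>
     banach_space \<Lambda> \<and>
     c00 scalar_space \<subseteq> carrier \<Lambda> \<and>
     embeds1 \<Lambda> (linf scalar_space) \<and>
     schauder_basis \<Lambda> unit_vec \<and>
     (\<forall>j. nrm \<Lambda> (unit_vec j) = 1)"

text \<open>As \<open>unit_vec\<close> is a Schauder basis of \<open>\<Lambda>\<close>, the functional in the norm is unique.\<close>

definition lower_star ::
  "('k::real_or_complex, nat \<Rightarrow> 'k) nspace \<Rightarrow> ('k, nat \<Rightarrow> 'k) nspace" where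
  "lower_star \<Lambda> = sequence_space scalar_space
     {(\<lambda>j. \<phi> (unit_vec j)) | \<phi>. \<phi> \<in> carrier (dual \<Lambda>)}
     (\<lambda>s. nrm (dual \<Lambda>) (THE \<phi>. \<phi> \<in> carrier (dual \<Lambda>) \<and> s = (\<lambda>j. \<phi> (unit_vec j))))"


section \<open>Tensor products and reasonable crossnorms\<close>

text \<open>
  The algebraic tensor product in its standard concrete form: \<open>x \<otimes> y\<close> is the functional
  \<open>A \<mapsto> A(x, y)\<close> on the space of all bilinear forms, and \<open>E \<otimes> F\<close> is the linear span of these
  functionals, that is, the set of their finite sums \<open>\<Sum>j<k. x j \<otimes> y j\<close>.
\<close>

definition bilinear_forms ::
  "('k::real_or_complex, 'a) nspace \<Rightarrow> ('k, 'b) nspace \<Rightarrow> ('a \<Rightarrow> 'b \<Rightarrow> 'k) set" where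
  "bilinear_forms E F =
     {A. (\<forall>y\<in>carrier F. linear_map E scalar_space (\<lambda>x. A x y)) \<and>
         (\<forall>x\<in>carrier E. linear_map F scalar_space (\<lambda>y. A x y)) \<and>
         (\<forall>x y. x \<notin> carrier E \<or> y \<notin> carrier F \<longrightarrow> A x y = 0)}"

type_synonym ('k, 'a, 'b) tensor = "('a \<Rightarrow> 'b \<Rightarrow> 'k) \<Rightarrow> 'k"

definition elem_tensor ::
  "('k::real_or_complex, 'a) nspace \<Rightarrow> ('k, 'b) nspace \<Rightarrow> 'a \<Rightarrow> 'b \<Rightarrow> ('k, 'a, 'b) tensor" where
  "elem_tensor E F x y = (\<lambda>A. if A \<in> bilinear_forms E F then A x y else 0)"

definition tensor_sum ::
  "('k::real_or_complex, 'a) nspace \<Rightarrow> ('k, 'b) nspace \<Rightarrow>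
   nat \<Rightarrow> (nat \<Rightarrow> 'a) \<Rightarrow> (nat \<Rightarrow> 'b) \<Rightarrow> ('k, 'a, 'b) tensor" where
  "tensor_sum E F k x y = (\<lambda>A. \<Sum>j<k. elem_tensor E F (x j) (y j) A)"

definition tensor_space ::
  "('k::real_or_complex, 'a) nspace \<Rightarrow> ('k, 'b) nspace \<Rightarrow>
   (('k, 'a, 'b) tensor \<Rightarrow> real) \<Rightarrow> ('k, ('k, 'a, 'b) tensor) nspace" where
  "tensor_space E F \<alpha> =
     \<lparr>carrier = {tensor_sum E F k x y | k x y.
                   \<forall>j<k. x j \<in> carrier E \<and> y j \<in> carrier F},
      mult = undefined, one = undefined,
      zero = (\<lambda>A. 0), add = (\<lambda>u v A. u A + v A), smult = (\<lambda>c u A. c * u A),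
      nrm = \<alpha>\<rparr>"

text \<open>\<open>\<phi> \<otimes> \<psi>\<close> evaluates a tensor at the bilinear form \<open>(x, y) \<mapsto> \<phi>(x) \<psi>(y)\<close>.\<close>

definition tensor_functional ::
  "('a \<Rightarrow> 'k::real_or_complex) \<Rightarrow> ('b \<Rightarrow> 'k) \<Rightarrow> ('k, 'a, 'b) tensor \<Rightarrow> 'k" where
  "tensor_functional \<phi> \<psi> u = u (\<lambda>x y. \<phi> x * \<psi> y)"

lemma tensor_functional_tensor_sum:
  assumes "\<phi> \<in> carrier (dual E)" and "\<psi> \<in> carrier (dual F)"
  shows "tensor_functional \<phi> \<psi> (tensor_sum E F k x y) = (\<Sum>j<k. \<phi> (x j) * \<psi> (y j))"
proof -
  have "(\<lambda>x y. \<phi> x * \<psi> y) \<in> bilinear_forms E F"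
    using assms
    by (auto simp: bilinear_forms_def dual_def bounded_linear_map_def linear_map_def
        scalar_space_def algebra_simps)
  then show ?thesis
    by (simp add: tensor_functional_def tensor_sum_def elem_tensor_def)
qed

definition reasonable_crossnorm ::
  "('k::real_or_complex, 'a) nspace \<Rightarrow> ('k, 'b) nspace \<Rightarrow> (('k, 'a, 'b) tensor \<Rightarrow> real) \<Rightarrow> bool" where
  "reasonable_crossnorm E F \<alpha> \<longleftrightarrow>
     normed_space (tensor_space E F \<alpha>) \<and>
     (\<forall>x\<in>carrier E. \<forall>y\<in>carrier F. \<alpha> (elem_tensor E F x y) \<le> nrm E x * nrm F y) \<and>
     (\<forall>\<phi>\<in>carrier (dual E). \<forall>\<psi>\<in>carrier (dual F).
        bounded_linear_map (tensor_space E F \<alpha>) scalar_space (tensor_functional \<phi> \<psi>) \<and>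
        op_norm (tensor_space E F \<alpha>) scalar_space (tensor_functional \<phi> \<psi>)
          \<le> nrm (dual E) \<phi> * nrm (dual F) \<psi>)"


section \<open>The expression \<open>\<alpha>\<^sub>\<lambda>\<close>\<close>

text \<open>
  The set whose supremum is taken, for a representation \<open>\<Sum>j<k. x j \<otimes> y j\<close> of a tensor;
  \<open>XE\<close> and \<open>YF\<close> stand for \<open>X(E')\<close> and \<open>Y(F')\<close>.
\<close>

definition alpha_set ::
  "('k::real_or_complex, nat \<Rightarrow> 'a \<Rightarrow> 'k) nspace \<Rightarrow> ('k, nat \<Rightarrow> 'b \<Rightarrow> 'k) nspace \<Rightarrow>
   nat \<Rightarrow> (nat \<Rightarrow> 'a) \<Rightarrow> (nat \<Rightarrow> 'b) \<Rightarrow> real set" where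
  "alpha_set XE YF k x y =
     {norm (\<Sum>j<k. \<Sum>n. \<phi> n (x j) * \<psi> n (y j)) | \<phi> \<psi>. \<phi> \<in> unit_ball XE \<and> \<psi> \<in> unit_ball YF}"

end

theory Submission
  imports Defs
begin

text \<open>
  Given \<open>\<phi>\<close> in the unit ball of \<open>X(E')\<close> and \<open>\<psi>\<close> in that of \<open>Y(F')\<close>, the formula
  \<open>B(x, y) = \<Sum>n. \<phi>\<^sub>n(x) \<psi>\<^sub>n(y)\<close> defines a bilinear form on \<open>E \<times> F\<close> with
  \<open>\<bar>B(x, y)\<bar> \<le> \<parallel>x\<parallel> \<parallel>y\<parallel>\<close>: evaluation at \<open>x\<close> is an operator on \<open>E'\<close> of norm at most \<open>\<parallel>x\<parallel>\<close>, so
  by linear stability \<open>(\<phi>\<^sub>n(x))\<^sub>n\<close> lies in the scalar space of the class \<open>X\<close>, hence in \<open>\<lambda>\<close>, with norm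
  at most \<open>\<parallel>x\<parallel>\<close>; likewise \<open>(\<psi>\<^sub>n(y))\<^sub>n\<close> comes from a functional on \<open>\<lambda>\<close> of norm at most \<open>\<parallel>y\<parallel>\<close>; and the
  value of this functional at \<open>(\<phi>\<^sub>n(x))\<^sub>n\<close> is the series, because the unit vectors form a Schauder
  basis (\<open>class_at_eval\<close>, \<open>lower_star_pairing\<close>, \<open>class_at_pairing\<close>).

  Thus \<open>\<alpha>\<^sub>\<lambda>(u)\<close> is the supremum of \<open>\<bar>u(B)\<bar>\<close> over a set of contractive bilinear forms. As a
  tensor is a function on bilinear forms, this does not depend on its representation. Moreover
  the set contains all products \<open>\<phi>(x) \<psi>(y)\<close> of functionals from the unit balls of \<open>E'\<close> and \<open>F'\<close>, by
  taking one-term sequences. These two properties of a set of forms already imply that the supremum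
  is a reasonable crossnorm (\<open>reasonable_crossnorm_sup_over_forms\<close>).

  The substantial point there is definiteness: a tensor on which all products of bounded functionals
  vanish is annihilated by every bilinear form, bounded or not (\<open>tensor_sum_eq_0\<close>). This is proved
  by eliminating one term after the other of a representation and rests on the fact that bounded
  functionals separate points (\<open>dual_separates_points\<close>), a form of the Hahn--Banach theorem that is
  derived here from minimal sublinear functionals.
\<close>

section \<open>Normed spaces\<close>

lemma scalar_space_simps [simp]:
  "carrier scalar_space = UNIV" "mult scalar_space = (*)" "one scalar_space = 1"
  "zero scalar_space = 0" "add scalar_space = (+)" "smult scalar_space = (*)"
  "nrm scalar_space = norm"
  by (simp_all add: scalar_space_def)

lemma cring_scalar_space: "cring (scalar_space :: ('k::real_or_complex, 'k) nspace)"
proof (rule cringI)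
  show "abelian_group (scalar_space :: ('k, 'k) nspace)"
    by (rule abelian_groupI) (auto simp: ac_simps intro: exI[of _ "- x" for x])
  show "comm_monoid (scalar_space :: ('k, 'k) nspace)"
    by (rule comm_monoidI) (auto simp: ac_simps)
qed (auto simp: algebra_simps)

text \<open>The additive inverse that the group axioms ask for is \<open>(- 1) \<odot> x\<close>.\<close>

lemma normed_spaceI:
  fixes V :: "('k::real_or_complex, 'a) nspace" (structure)
  assumes "\<And>x y. \<lbrakk>x \<in> carrier V; y \<in> carrier V\<rbrakk> \<Longrightarrow> x \<oplus> y \<in> carrier V"
    and "\<zero> \<in> carrier V"
    and "\<And>c x. x \<in> carrier V \<Longrightarrow> c \<odot> x \<in> carrier V"
    and "\<And>x y z. \<lbrakk>x \<in> carrier V; y \<in> carrier V; z \<in> carrier V\<rbrakk> \<Longrightarrow> (x \<oplus> y) \<oplus> z = x \<oplus> (y \<oplus> z)"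
    and "\<And>x y. \<lbrakk>x \<in> carrier V; y \<in> carrier V\<rbrakk> \<Longrightarrow> x \<oplus> y = y \<oplus> x"
    and "\<And>x. x \<in> carrier V \<Longrightarrow> \<zero> \<oplus> x = x"
    and "\<And>x. x \<in> carrier V \<Longrightarrow> (- 1) \<odot> x \<oplus> x = \<zero>"
    and "\<And>a b x. x \<in> carrier V \<Longrightarrow> (a + b) \<odot> x = a \<odot> x \<oplus> b \<odot> x"
    and "\<And>a x y. \<lbrakk>x \<in> carrier V; y \<in> carrier V\<rbrakk> \<Longrightarrow> a \<odot> (x \<oplus> y) = a \<odot> x \<oplus> a \<odot> y"
    and "\<And>a b x. x \<in> carrier V \<Longrightarrow> (a * b) \<odot> x = a \<odot> (b \<odot> x)"
    and "\<And>x. x \<in> carrier V \<Longrightarrow> 1 \<odot> x = x"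
    and "\<And>x. x \<in> carrier V \<Longrightarrow> 0 \<le> nrm V x"
    and "\<And>x. x \<in> carrier V \<Longrightarrow> nrm V x = 0 \<longleftrightarrow> x = \<zero>"
    and "\<And>c x. x \<in> carrier V \<Longrightarrow> nrm V (c \<odot> x) = norm c * nrm V x"
    and "\<And>x y. \<lbrakk>x \<in> carrier V; y \<in> carrier V\<rbrakk> \<Longrightarrow> nrm V (x \<oplus> y) \<le> nrm V x + nrm V y"
  shows "normed_space V"
proof -
  have "abelian_group V"
    by (rule abelian_groupI) (use assms in blast)+
  then have "Module.module (scalar_space :: ('k, 'k) nspace) V"
    by (intro moduleI cring_scalar_space) (simp_all add: assms)
  then show ?thesis
    unfolding normed_space_def using assms(12-15) by blast
qed

locale normed =
  fixes V :: "('k::real_or_complex, 'a) nspace" (structure)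
  assumes normed: "normed_space V"
begin

lemma module: "Module.module (scalar_space :: ('k, 'k) nspace) V"
  using normed by (simp add: normed_space_def)

lemma abelian_group: "abelian_group V"
  using module by (simp add: Module.module_def)

lemma zero_closed [simp]: "\<zero> \<in> carrier V"
  and add_closed [simp]: "\<lbrakk>x \<in> carrier V; y \<in> carrier V\<rbrakk> \<Longrightarrow> x \<oplus> y \<in> carrier V"
  and minus_closed [simp]: "\<lbrakk>x \<in> carrier V; y \<in> carrier V\<rbrakk> \<Longrightarrow> x \<ominus> y \<in> carrier V"
  and add_assoc:
    "\<lbrakk>x \<in> carrier V; y \<in> carrier V; z \<in> carrier V\<rbrakk> \<Longrightarrow> x \<oplus> y \<oplus> z = x \<oplus> (y \<oplus> z)"
  and add_comm: "\<lbrakk>x \<in> carrier V; y \<in> carrier V\<rbrakk> \<Longrightarrow> x \<oplus> y = y \<oplus> x"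
  and add_left_comm:
    "\<lbrakk>x \<in> carrier V; y \<in> carrier V; z \<in> carrier V\<rbrakk> \<Longrightarrow> x \<oplus> (y \<oplus> z) = y \<oplus> (x \<oplus> z)"
  and l_zero [simp]: "x \<in> carrier V \<Longrightarrow> \<zero> \<oplus> x = x"
  and r_zero [simp]: "x \<in> carrier V \<Longrightarrow> x \<oplus> \<zero> = x"
  and minus_eq_zero_iff: "\<lbrakk>x \<in> carrier V; y \<in> carrier V\<rbrakk> \<Longrightarrow> x \<ominus> y = \<zero> \<longleftrightarrow> x = y"
proof -
  interpret abelian_group V by (rule abelian_group)
  show "\<zero> \<in> carrier V" by simp
  show "x \<oplus> y \<in> carrier V" if "x \<in> carrier V" "y \<in> carrier V" using that by simp
  show "x \<ominus> y \<in> carrier V" if "x \<in> carrier V" "y \<in> carrier V" using that by simp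
  show "x \<oplus> y \<oplus> z = x \<oplus> (y \<oplus> z)" if "x \<in> carrier V" "y \<in> carrier V" "z \<in> carrier V"
    using that by (rule a_assoc)
  show "x \<oplus> y = y \<oplus> x" if "x \<in> carrier V" "y \<in> carrier V" using that by (rule a_comm)
  show "x \<oplus> (y \<oplus> z) = y \<oplus> (x \<oplus> z)"
    if "x \<in> carrier V" "y \<in> carrier V" "z \<in> carrier V" using that by (rule a_lcomm)
  show "\<zero> \<oplus> x = x" "x \<oplus> \<zero> = x" if "x \<in> carrier V"
    using that by simp_all
  show "x \<ominus> y = \<zero> \<longleftrightarrow> x = y" if "x \<in> carrier V" "y \<in> carrier V"
    using that by (metis a_minus_def a_inv_closed minus_equality minus_minus r_neg)
qed

lemma smult_closed [simp]: "x \<in> carrier V \<Longrightarrow> c \<odot> x \<in> carrier V"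
  and smult_add_left: "x \<in> carrier V \<Longrightarrow> (a + b) \<odot> x = a \<odot> x \<oplus> b \<odot> x"
  and smult_add_right: "\<lbrakk>x \<in> carrier V; y \<in> carrier V\<rbrakk> \<Longrightarrow> a \<odot> (x \<oplus> y) = a \<odot> x \<oplus> a \<odot> y"
  and smult_smult [simp]: "x \<in> carrier V \<Longrightarrow> a \<odot> (b \<odot> x) = (a * b) \<odot> x"
  and smult_1 [simp]: "x \<in> carrier V \<Longrightarrow> 1 \<odot> x = x"
  and smult_0 [simp]: "x \<in> carrier V \<Longrightarrow> 0 \<odot> x = \<zero>"
  and smult_zero [simp]: "c \<odot> \<zero> = \<zero>"
  and minus_eq: "\<lbrakk>x \<in> carrier V; y \<in> carrier V\<rbrakk> \<Longrightarrow> x \<ominus> y = x \<oplus> (- 1) \<odot> y"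
proof -
  interpret M: Module.module "scalar_space :: ('k, 'k) nspace" V by (rule module)
  show 1: "c \<odot> x \<in> carrier V" if "x \<in> carrier V" for c x
    using M.smult_closed[of c x] that by simp
  show 2: "(a + b) \<odot> x = a \<odot> x \<oplus> b \<odot> x" if "x \<in> carrier V" for a b x
    using M.smult_l_distr[of a b x] that by simp
  show "a \<odot> (x \<oplus> y) = a \<odot> x \<oplus> a \<odot> y" if "x \<in> carrier V" "y \<in> carrier V"
    using M.smult_r_distr[of a x y] that by simp
  show "a \<odot> (b \<odot> x) = (a * b) \<odot> x" if "x \<in> carrier V"
    using M.smult_assoc1[of a b x] that by simp
  show 3: "1 \<odot> x = x" if "x \<in> carrier V" for x
    using M.smult_one[of x] that by simp
  show 4: "0 \<odot> x = \<zero>" if "x \<in> carrier V" for x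
    using M.smult_l_null[of x] that by simp
  show "c \<odot> \<zero> = \<zero>"
    using M.smult_r_null[of c] by simp
  show "x \<ominus> y = x \<oplus> (- 1) \<odot> y" if "x \<in> carrier V" "y \<in> carrier V"
  proof -
    have "(- 1) \<odot> y \<oplus> y = \<zero>"
      using 2[of y "- 1" 1] 3[of y] 4[of y] that by simp
    then have "\<ominus> y = (- 1) \<odot> y"
      using that 1 by (metis M.minus_equality)
    then show ?thesis
      by (simp add: a_minus_def)
  qed
qed

lemma nrm_nonneg [simp]: "x \<in> carrier V \<Longrightarrow> 0 \<le> nrm V x"
  and nrm_eq_0: "x \<in> carrier V \<Longrightarrow> nrm V x = 0 \<longleftrightarrow> x = \<zero>"
  and nrm_smult: "x \<in> carrier V \<Longrightarrow> nrm V (c \<odot> x) = norm c * nrm V x"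
  and nrm_triangle: "\<lbrakk>x \<in> carrier V; y \<in> carrier V\<rbrakk> \<Longrightarrow> nrm V (x \<oplus> y) \<le> nrm V x + nrm V y"
  using normed by (simp_all add: normed_space_def)

lemma nrm_zero [simp]: "nrm V \<zero> = 0"
  by (simp add: nrm_eq_0)

lemma nrm_minus_commute:
  assumes "x \<in> carrier V" "y \<in> carrier V" shows "nrm V (x \<ominus> y) = nrm V (y \<ominus> x)"
proof -
  have "y \<ominus> x = (- 1) \<odot> (x \<ominus> y)"
    using assms by (simp add: minus_eq smult_add_right add_comm)
  then show ?thesis
    using assms by (simp add: nrm_smult)
qed

lemma minus_add_minus:
  assumes "x \<in> carrier V" "y \<in> carrier V" "z \<in> carrier V"
  shows "(x \<ominus> y) \<oplus> (y \<ominus> z) = x \<ominus> z"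
proof -
  have "(x \<ominus> y) \<oplus> (y \<ominus> z) = x \<oplus> ((-1) \<odot> y \<oplus> (y \<oplus> (-1) \<odot> z))"
    using assms by (simp add: minus_eq add_assoc)
  also have "(-1) \<odot> y \<oplus> (y \<oplus> (-1) \<odot> z) = ((-1) \<odot> y \<oplus> 1 \<odot> y) \<oplus> (-1) \<odot> z"
    using assms by (simp add: add_assoc)
  also have "\<dots> = (-1) \<odot> z"
    using assms smult_add_left[of y "- 1" 1, symmetric] by simp
  finally show ?thesis
    using assms by (simp add: minus_eq)
qed

lemma nrm_minus_triangle:
  assumes "x \<in> carrier V" "y \<in> carrier V" "z \<in> carrier V"
  shows "nrm V (x \<ominus> z) \<le> nrm V (x \<ominus> y) + nrm V (y \<ominus> z)"
  using nrm_triangle[of "x \<ominus> y" "y \<ominus> z"] assms by (simp add: minus_add_minus)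

lemma Metric_space: "Metric_space (carrier V) (ndist V)"
proof
  fix x y z
  show "0 \<le> ndist V x y"
    by (simp add: ndist_def)
  show "ndist V x y = ndist V y x"
    by (simp add: ndist_def nrm_minus_commute)
  show "ndist V x y = 0 \<longleftrightarrow> x = y" if "x \<in> carrier V" "y \<in> carrier V"
    using that by (simp add: ndist_def nrm_eq_0 minus_eq_zero_iff)
  show "ndist V x z \<le> ndist V x y + ndist V y z"
    if "x \<in> carrier V" "y \<in> carrier V" "z \<in> carrier V"
    using that by (simp add: ndist_def nrm_minus_triangle)
qed

text \<open>The metric behind \<open>banach_space\<close> is defined by cases outside the carrier. With the following two
  notions, linked to it by \<open>banach_space_iff\<close>, completeness becomes a statement about norms.\<close>

definition norm_Cauchy :: "(nat \<Rightarrow> 'a) \<Rightarrow> bool" where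
  "norm_Cauchy s \<longleftrightarrow> (\<forall>n. s n \<in> carrier V) \<and>
     (\<forall>e>0. \<exists>N. \<forall>m\<ge>N. \<forall>n\<ge>N. nrm V (s m \<ominus> s n) < e)"

definition norm_limit :: "(nat \<Rightarrow> 'a) \<Rightarrow> 'a \<Rightarrow> bool" where
  "norm_limit s l \<longleftrightarrow> l \<in> carrier V \<and> (\<forall>e>0. \<exists>N. \<forall>n\<ge>N. nrm V (s n \<ominus> l) < e)"

lemma banach_space_iff:
  "banach_space V \<longleftrightarrow> (\<forall>s. norm_Cauchy s \<longrightarrow> (\<exists>l. norm_limit s l))"
proof -
  interpret M: Metric_space "carrier V" "ndist V" by (rule Metric_space)
  have C: "M.MCauchy s \<longleftrightarrow> norm_Cauchy s" for s
    unfolding M.MCauchy_def norm_Cauchy_def image_subset_iff ndist_def by (auto; meson)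
  have L: "limitin M.mtopology s l sequentially \<longleftrightarrow> norm_limit s l" if "\<forall>n. s n \<in> carrier V" for s l
    unfolding M.limit_metric_sequentially norm_limit_def ndist_def using that by auto
  show ?thesis
    unfolding banach_space_def M.mcomplete_def C using L normed
    by (metis norm_Cauchy_def)
qed

end

lemma banach_normed: "banach_space V \<Longrightarrow> normed V"
  by (simp add: banach_space_def normed_def)


section \<open>Bounded linear maps and their norm\<close>

lemma op_norm_le:
  assumes "\<And>x. x \<in> carrier V \<Longrightarrow> nrm W (T x) \<le> C * nrm V x" and "0 \<le> C" and "normed V"
  shows "op_norm V W T \<le> C"
  unfolding op_norm_def
proof (rule cSUP_least)
  interpret normed V by fact
  show "unit_ball V \<noteq> {}"
    by (auto simp: unit_ball_def intro: exI[of _ "\<zero>\<^bsub>V\<^esub>"])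
  fix x assume x: "x \<in> unit_ball V"
  then have "nrm W (T x) \<le> C * nrm V x"
    using assms by (simp add: unit_ball_def)
  also have "\<dots> \<le> C * 1"
    using x assms by (intro mult_left_mono) (auto simp: unit_ball_def)
  finally show "nrm W (T x) \<le> C" by simp
qed

lemma bounded_linear_map_bdd_above:
  assumes "bounded_linear_map V W T" and "normed V"
  shows "bdd_above ((\<lambda>x. nrm W (T x)) ` unit_ball V)"
proof -
  interpret normed V by fact
  obtain C where C: "\<And>x. x \<in> carrier V \<Longrightarrow> nrm W (T x) \<le> C * nrm V x"
    using assms by (auto simp: bounded_linear_map_def)
  have "nrm W (T x) \<le> \<bar>C\<bar>" if "x \<in> unit_ball V" for x
  proof -
    have x: "x \<in> carrier V" "nrm V x \<le> 1"
      using that by (auto simp: unit_ball_def)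
    have "C * nrm V x \<le> \<bar>C\<bar> * 1"
      using x by (intro mult_mono) auto
    with C[OF x(1)] show ?thesis by simp
  qed
  then show ?thesis
    by (auto intro!: bdd_aboveI)
qed

lemma bounded_linear_map_le_op_norm:
  assumes T: "bounded_linear_map V W T" and "normed V" "normed W" and x: "x \<in> carrier V"
  shows "nrm W (T x) \<le> op_norm V W T * nrm V x"
proof -
  interpret V: normed V by fact
  interpret W: normed W by fact
  have lin: "T y \<in> carrier W" "T (c \<odot>\<^bsub>V\<^esub> y) = c \<odot>\<^bsub>W\<^esub> T y" if "y \<in> carrier V" for c y
    using T that by (auto simp: bounded_linear_map_def linear_map_def)
  show ?thesis
  proof (cases "nrm V x = 0")
    case True
    then have "T x = \<zero>\<^bsub>W\<^esub>"
      using lin(2)[of x 0] lin(1)[of x] x by (simp add: V.nrm_eq_0)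
    with True show ?thesis by simp
  next
    case False
    then have pos: "0 < nrm V x"
      using x V.nrm_nonneg[of x] by linarith
    let ?c = "of_real (inverse (nrm V x))"
    have "?c \<odot>\<^bsub>V\<^esub> x \<in> unit_ball V"
      using x pos by (auto simp: unit_ball_def V.nrm_smult norm_inverse)
    then have "nrm W (T (?c \<odot>\<^bsub>V\<^esub> x)) \<le> op_norm V W T"
      unfolding op_norm_def
      using bounded_linear_map_bdd_above[OF T \<open>normed V\<close>] by (intro cSUP_upper)
    then have "inverse (nrm V x) * nrm W (T x) \<le> op_norm V W T"
      using x pos by (simp add: lin W.nrm_smult norm_inverse)
    then show ?thesis
      using pos by (simp add: field_simps)
  qed
qed

lemma op_norm_nonneg:
  assumes T: "bounded_linear_map V W T" and "normed V" "normed W"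
  shows "0 \<le> op_norm V W T"
proof -
  interpret V: normed V by fact
  interpret W: normed W by fact
  have "nrm W (T \<zero>\<^bsub>V\<^esub>) \<le> op_norm V W T"
    unfolding op_norm_def
    using bounded_linear_map_bdd_above[OF T \<open>normed V\<close>]
    by (intro cSUP_upper) (simp_all add: unit_ball_def)
  moreover have "0 \<le> nrm W (T \<zero>\<^bsub>V\<^esub>)"
    using T by (auto simp: bounded_linear_map_def linear_map_def)
  ultimately show ?thesis by linarith
qed


section \<open>Completeness of the scalar field, of duals and of isometric copies\<close>

lemma normed_scalar_space: "normed (scalar_space :: ('k::real_or_complex, 'k) nspace)"
  unfolding normed_def
  by (rule normed_spaceI) (auto simp: algebra_simps norm_mult norm_triangle_ineq)

lemma scalar_space_minus [simp]:
  "x \<ominus>\<^bsub>scalar_space :: ('k::real_or_complex, 'k) nspace\<^esub> y = x - y"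
  by (simp add: normed.minus_eq[OF normed_scalar_space])

lemma banach_scalar_space: "banach_space (scalar_space :: ('k::real_or_complex, 'k) nspace)"
proof -
  interpret normed "scalar_space :: ('k, 'k) nspace" by (rule normed_scalar_space)
  have "\<exists>l. norm_limit s l" if "norm_Cauchy s" for s
  proof -
    have "Cauchy s"
      using that unfolding norm_Cauchy_def Cauchy_def by (simp add: dist_norm)
    then obtain l where "s \<longlonglongrightarrow> l"
      using Cauchy_convergent convergent_def by blast
    then show ?thesis
      unfolding norm_limit_def LIMSEQ_def by (auto simp: dist_norm)
  qed
  then show ?thesis
    by (simp add: banach_space_iff)
qed

lemma dual_simps [simp]:
  "zero (dual V) = (\<lambda>x. 0)" "add (dual V) = (\<lambda>\<phi> \<psi> x. \<phi> x + \<psi> x)"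
  "smult (dual V) = (\<lambda>c \<phi> x. c * \<phi> x)" "nrm (dual V) = op_norm V scalar_space"
  by (simp_all add: dual_def)

lemma dual_carrierD:
  assumes "\<phi> \<in> carrier (dual V)"
  shows "bounded_linear_map V scalar_space \<phi>" and "x \<notin> carrier V \<Longrightarrow> \<phi> x = 0"
    and "\<lbrakk>x \<in> carrier V; y \<in> carrier V\<rbrakk> \<Longrightarrow> \<phi> (x \<oplus>\<^bsub>V\<^esub> y) = \<phi> x + \<phi> y"
    and "x \<in> carrier V \<Longrightarrow> \<phi> (c \<odot>\<^bsub>V\<^esub> x) = c * \<phi> x"
  using assms by (auto simp: dual_def bounded_linear_map_def linear_map_def)

lemma dual_carrierI:
  assumes "\<And>x y. \<lbrakk>x \<in> carrier V; y \<in> carrier V\<rbrakk> \<Longrightarrow> \<phi> (x \<oplus>\<^bsub>V\<^esub> y) = \<phi> x + \<phi> y"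
    and "\<And>c x. x \<in> carrier V \<Longrightarrow> \<phi> (c \<odot>\<^bsub>V\<^esub> x) = c * \<phi> x"
    and "\<And>x. x \<in> carrier V \<Longrightarrow> norm (\<phi> x) \<le> C * nrm V x"
    and "\<And>x. x \<notin> carrier V \<Longrightarrow> \<phi> x = 0"
  shows "\<phi> \<in> carrier (dual V)"
  using assms by (auto simp: dual_def bounded_linear_map_def linear_map_def intro!: exI[of _ C])

context normed begin

lemma dual_bound:
  assumes "\<phi> \<in> carrier (dual V)" "x \<in> carrier V"
  shows "norm (\<phi> x) \<le> nrm (dual V) \<phi> * nrm V x"
  using bounded_linear_map_le_op_norm[OF dual_carrierD(1)[OF assms(1)] _ normed_scalar_space assms(2)]
  by (simp add: normed_axioms)

lemma dual_nrm_le: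
  assumes "\<And>x. x \<in> carrier V \<Longrightarrow> norm (\<phi> x) \<le> C * nrm V x" "0 \<le> C"
  shows "nrm (dual V) \<phi> \<le> C"
  using op_norm_le[of V "scalar_space :: ('k, 'k) nspace" \<phi> C] assms normed_axioms by simp

lemma dual_nrm_nonneg: "\<phi> \<in> carrier (dual V) \<Longrightarrow> 0 \<le> nrm (dual V) \<phi>"
  using op_norm_nonneg[OF dual_carrierD(1) normed_axioms normed_scalar_space] by simp

lemma normed_dual: "normed (dual V)"
  unfolding normed_def
proof (rule normed_spaceI)
  fix \<phi> \<psi> c assume \<phi>: "\<phi> \<in> carrier (dual V)"
  note d = dual_carrierD[OF \<phi>]
  show smult: "c \<odot>\<^bsub>dual V\<^esub> \<phi> \<in> carrier (dual V)" for c
    by (rule dual_carrierI[where C = "norm c * nrm (dual V) \<phi>"])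
      (use d dual_bound[OF \<phi>] in \<open>auto simp: algebra_simps norm_mult intro: mult_left_mono\<close>)
  show "0 \<le> nrm (dual V) \<phi>"
    using \<phi> by (rule dual_nrm_nonneg)
  show "nrm (dual V) \<phi> = 0 \<longleftrightarrow> \<phi> = \<zero>\<^bsub>dual V\<^esub>"
  proof
    assume "nrm (dual V) \<phi> = 0"
    then show "\<phi> = \<zero>\<^bsub>dual V\<^esub>"
      using dual_bound[OF \<phi>] d(2) by (auto simp: fun_eq_iff)
  next
    assume "\<phi> = \<zero>\<^bsub>dual V\<^esub>"
    then show "nrm (dual V) \<phi> = 0"
      using dual_nrm_le[of \<phi> 0] dual_nrm_nonneg[OF \<phi>] by simp
  qed
  have le: "nrm (dual V) (c \<odot>\<^bsub>dual V\<^esub> \<theta>) \<le> norm c * nrm (dual V) \<theta>"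
    if "\<theta> \<in> carrier (dual V)" for c \<theta>
    using dual_bound[OF that] dual_nrm_nonneg[OF that]
    by (intro dual_nrm_le) (auto simp: norm_mult algebra_simps intro: mult_left_mono)
  show "nrm (dual V) (c \<odot>\<^bsub>dual V\<^esub> \<phi>) = norm c * nrm (dual V) \<phi>"
  proof (cases "c = 0")
    case True
    then show ?thesis
      using le[OF \<phi>, of c] dual_nrm_nonneg[OF smult[of c]] by simp
  next
    case False
    have "nrm (dual V) \<phi> \<le> norm (inverse c) * nrm (dual V) (c \<odot>\<^bsub>dual V\<^esub> \<phi>)"
      using le[OF smult[of c], of "inverse c"] False by (simp flip: mult.assoc)
    then show ?thesis
      using le[OF \<phi>, of c] False by (simp add: norm_divide inverse_eq_divide field_simps)
  qed
  assume \<psi>: "\<psi> \<in> carrier (dual V)"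
  have bound: "norm ((\<phi> \<oplus>\<^bsub>dual V\<^esub> \<psi>) x) \<le> (nrm (dual V) \<phi> + nrm (dual V) \<psi>) * nrm V x"
    if "x \<in> carrier V" for x
    using norm_triangle_ineq[of "\<phi> x" "\<psi> x"] dual_bound[OF \<phi> that] dual_bound[OF \<psi> that]
    by (simp add: algebra_simps)
  show "\<phi> \<oplus>\<^bsub>dual V\<^esub> \<psi> \<in> carrier (dual V)"
    by (rule dual_carrierI[OF _ _ bound])
      (use d dual_carrierD[OF \<psi>] in \<open>auto simp: algebra_simps\<close>)
  show "nrm (dual V) (\<phi> \<oplus>\<^bsub>dual V\<^esub> \<psi>) \<le> nrm (dual V) \<phi> + nrm (dual V) \<psi>"
    using dual_nrm_nonneg[OF \<phi>] dual_nrm_nonneg[OF \<psi>] by (intro dual_nrm_le bound) simp_all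
next
  show "\<zero>\<^bsub>dual V\<^esub> \<in> carrier (dual V)"
    by (rule dual_carrierI[where C = 0]) auto
qed (auto simp: fun_eq_iff algebra_simps)

lemma dual_minus:
  assumes "\<phi> \<in> carrier (dual V)" "\<psi> \<in> carrier (dual V)"
  shows "\<phi> \<ominus>\<^bsub>dual V\<^esub> \<psi> = (\<lambda>x. \<phi> x - \<psi> x)"
  using assms by (simp add: normed.minus_eq[OF normed_dual])

text \<open>A Cauchy sequence of functionals converges pointwise, and the Cauchy estimate survives the
  pointwise limit in its second argument; this makes the limit bounded and the convergence one in
  norm.\<close>

lemma banach_dual: "banach_space (dual V)"
proof -
  interpret D: normed "dual V" by (rule normed_dual)
  have "\<exists>l. D.norm_limit s l" if "D.norm_Cauchy s" for s
  proof -
    have s: "s n \<in> carrier (dual V)" for n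
      using that by (simp add: D.norm_Cauchy_def)
    have Cauchy: "\<exists>N. \<forall>m\<ge>N. \<forall>n\<ge>N. nrm (dual V) (s m \<ominus>\<^bsub>dual V\<^esub> s n) < e" if "0 < e" for e
      using \<open>D.norm_Cauchy s\<close> that by (simp add: D.norm_Cauchy_def)
    have bound: "norm (s m x - s n x) \<le> nrm (dual V) (s m \<ominus>\<^bsub>dual V\<^esub> s n) * nrm V x"
      if "x \<in> carrier V" for m n x
      using dual_bound[OF D.minus_closed[OF s s] that, of m n] by (simp add: dual_minus[OF s s])
    have "\<exists>l. (\<lambda>n. s n x) \<longlonglongrightarrow> l" for x
    proof (cases "x \<in> carrier V")
      case True
      have "Cauchy (\<lambda>n. s n x)"
      proof (rule CauchyI)
        fix e :: real assume "0 < e"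
        then have "0 < e / (nrm V x + 1)"
          using nrm_nonneg[OF True] by (simp add: add_nonneg_pos)
        then obtain N where N: "\<And>m n. \<lbrakk>m \<ge> N; n \<ge> N\<rbrakk> \<Longrightarrow>
            nrm (dual V) (s m \<ominus>\<^bsub>dual V\<^esub> s n) < e / (nrm V x + 1)"
          using Cauchy by blast
        show "\<exists>M. \<forall>m\<ge>M. \<forall>n\<ge>M. norm (s m x - s n x) < e"
        proof (intro exI allI impI)
          fix m n assume "m \<ge> N" "n \<ge> N"
          have "norm (s m x - s n x) \<le> e / (nrm V x + 1) * nrm V x"
            using bound[OF True, of m n] N[OF \<open>m \<ge> N\<close> \<open>n \<ge> N\<close>] nrm_nonneg[OF True]
            by (smt (verit) mult_right_mono)
          also have "\<dots> < e"
            using \<open>0 < e\<close> nrm_nonneg[OF True] by (simp add: field_simps)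
          finally show "norm (s m x - s n x) < e" .
        qed
      qed
      then show ?thesis
        using Cauchy_convergent convergent_def by blast
    next
      case False
      then show ?thesis
        using dual_carrierD(2)[OF s] by auto
    qed
    then obtain l where l: "\<And>x. (\<lambda>n. s n x) \<longlonglongrightarrow> l x"
      by metis
    have l_dist: "norm (s m x - l x) \<le> e * nrm V x"
      if "\<forall>m\<ge>N. \<forall>n\<ge>N. nrm (dual V) (s m \<ominus>\<^bsub>dual V\<^esub> s n) < e" "m \<ge> N" "x \<in> carrier V" for N e m x
    proof (rule LIMSEQ_le_const2)
      show "(\<lambda>n. norm (s m x - s n x)) \<longlonglongrightarrow> norm (s m x - l x)"
        by (intro tendsto_intros l)
      show "\<exists>N. \<forall>n\<ge>N. norm (s m x - s n x) \<le> e * nrm V x"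
        using bound[OF that(3), of m] that nrm_nonneg[OF that(3)]
        by (smt (verit, best) mult_right_mono)
    qed
    have l_closed: "l \<in> carrier (dual V)"
    proof -
      obtain N where N: "\<forall>m\<ge>N. \<forall>n\<ge>N. nrm (dual V) (s m \<ominus>\<^bsub>dual V\<^esub> s n) < 1"
        using Cauchy[of 1] by auto
      show ?thesis
      proof (rule dual_carrierI[where C = "1 + nrm (dual V) (s N)"])
        show "l (x \<oplus> y) = l x + l y" if "x \<in> carrier V" "y \<in> carrier V" for x y
          using LIMSEQ_unique[OF l[of "x \<oplus> y"]] tendsto_add[OF l[of x] l[of y]]
          by (simp add: dual_carrierD(3)[OF s] that)
        show "l (c \<odot> x) = c * l x" if "x \<in> carrier V" for c x
          using LIMSEQ_unique[OF l[of "c \<odot> x"]] tendsto_mult_left[OF l[of x], of c]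
          by (simp add: dual_carrierD(4)[OF s] that)
        show "norm (l x) \<le> (1 + nrm (dual V) (s N)) * nrm V x" if "x \<in> carrier V" for x
          using l_dist[OF N _ that, of N] dual_bound[OF s that, of N]
            norm_triangle_ineq4[of "s N x" "s N x - l x"]
          by (simp add: algebra_simps)
        show "l x = 0" if "x \<notin> carrier V" for x
          using l[of x] dual_carrierD(2)[OF s that] by (simp add: LIMSEQ_const_iff)
      qed
    qed
    have "\<exists>N. \<forall>n\<ge>N. nrm (dual V) (s n \<ominus>\<^bsub>dual V\<^esub> l) < e" if "0 < e" for e
    proof -
      obtain N where N: "\<forall>m\<ge>N. \<forall>n\<ge>N. nrm (dual V) (s m \<ominus>\<^bsub>dual V\<^esub> s n) < e / 2"
        using Cauchy[of "e / 2"] \<open>0 < e\<close> by auto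
      have "nrm (dual V) (s n \<ominus>\<^bsub>dual V\<^esub> l) \<le> e / 2" if "n \<ge> N" for n
        using l_dist[OF N that] \<open>0 < e\<close>
        by (intro dual_nrm_le) (simp_all add: dual_minus[OF s l_closed])
      then show ?thesis
        using \<open>0 < e\<close> by (metis field_sum_of_halves less_add_same_cancel1 half_gt_zero order_le_less_trans)
    qed
    then show ?thesis
      unfolding D.norm_limit_def using l_closed by blast
  qed
  then show ?thesis
    by (simp add: D.banach_space_iff)
qed

end

lemma copy_simps:
  assumes "inj_on \<iota> (carrier V)"
  shows "carrier (copy \<iota> V) = \<iota> ` carrier V"
    and "zero (copy \<iota> V) = \<iota> (zero V)"
    and "\<lbrakk>x \<in> carrier V; y \<in> carrier V\<rbrakk> \<Longrightarrow> \<iota> x \<oplus>\<^bsub>copy \<iota> V\<^esub> \<iota> y = \<iota> (x \<oplus>\<^bsub>V\<^esub> y)"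
    and "x \<in> carrier V \<Longrightarrow> c \<odot>\<^bsub>copy \<iota> V\<^esub> \<iota> x = \<iota> (c \<odot>\<^bsub>V\<^esub> x)"
    and "x \<in> carrier V \<Longrightarrow> nrm (copy \<iota> V) (\<iota> x) = nrm V x"
  using assms by (simp_all add: copy_def Let_def)

text \<open>Every notion involved is transported along the bijection \<open>\<iota>\<close>; a Cauchy sequence of the copy
  is pulled back to \<open>V\<close>, where it converges.\<close>

lemma banach_copy:
  assumes V: "banach_space V" and inj: "inj_on \<iota> (carrier V)"
  shows "banach_space (copy \<iota> V)"
proof -
  interpret V: normed V
    using V by (rule banach_normed)
  note c = copy_simps[OF inj]
  have neg: "(- 1) \<odot>\<^bsub>V\<^esub> x \<oplus>\<^bsub>V\<^esub> x = \<zero>\<^bsub>V\<^esub>" if "x \<in> carrier V" for x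
    using V.smult_add_left[of x "- 1" 1] that by simp
  have "normed (copy \<iota> V)"
    unfolding normed_def
    by (rule normed_spaceI)
      (auto simp: c V.add_assoc V.smult_add_left V.smult_add_right V.nrm_eq_0
        V.nrm_smult V.nrm_triangle inj_on_eq_iff[OF inj] neg intro: V.add_comm)
  then interpret C: normed "copy \<iota> V" .
  have minus: "\<iota> x \<ominus>\<^bsub>copy \<iota> V\<^esub> \<iota> y = \<iota> (x \<ominus>\<^bsub>V\<^esub> y)" if "x \<in> carrier V" "y \<in> carrier V" for x y
    using that by (simp add: C.minus_eq V.minus_eq c)
  have "\<exists>l. C.norm_limit s l" if "C.norm_Cauchy s" for s
  proof -
    have "\<forall>n. \<exists>x. x \<in> carrier V \<and> s n = \<iota> x"
      using that by (auto simp: C.norm_Cauchy_def c)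
    then obtain t where t: "\<And>n. t n \<in> carrier V" and s: "s = (\<lambda>n. \<iota> (t n))"
      by metis
    have "V.norm_Cauchy t"
      using that t by (auto simp: C.norm_Cauchy_def V.norm_Cauchy_def s minus c)
    then obtain l where "V.norm_limit t l"
      using V V.banach_space_iff by blast
    then have "C.norm_limit s (\<iota> l)"
      using t by (auto simp: C.norm_limit_def V.norm_limit_def s minus c)
    then show ?thesis ..
  qed
  then show ?thesis
    by (simp add: C.banach_space_iff)
qed


section \<open>Functionals separate points\<close>

text \<open>The Hahn--Banach theorem is needed only in the form that a nonzero vector is not annihilated by all
  bounded functionals. Instead of extending functionals from subspaces, one works with sublinear
  functionals on the whole space: a minimal one, which Zorn's lemma provides below any given one, is
  real-linear.

  Functionals vanish outside the carrier, so that two of them are equal as HOL functions as soon as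
  they agree on the carrier. Requiring homogeneity only as an inequality for
  \<open>t > 0\<close> keeps the closure properties short; equality follows by scaling with \<open>1 / t\<close>.\<close>

definition sublinear :: "('k::real_or_complex, 'a) nspace \<Rightarrow> ('a \<Rightarrow> real) \<Rightarrow> bool" where
  "sublinear V q \<longleftrightarrow>
     (\<forall>x\<in>carrier V. \<forall>y\<in>carrier V. q (x \<oplus>\<^bsub>V\<^esub> y) \<le> q x + q y) \<and>
     (\<forall>t>0. \<forall>x\<in>carrier V. q (of_real t \<odot>\<^bsub>V\<^esub> x) \<le> t * q x) \<and>
     (\<forall>x. x \<notin> carrier V \<longrightarrow> q x = 0)"

text \<open>For sublinear \<open>q\<close>, the largest sublinear functional below \<open>q\<close> whose value at \<open>- y\<close> is at most \<open>- q(y)\<close>. It is used twice: a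
  minimal \<open>q\<close> equals all its tilts, which makes it additive, and below the norm tilted towards
  \<open>x0\<close> every sublinear functional takes the value \<open>\<parallel>x0\<parallel>\<close> at \<open>x0\<close>.\<close>

definition tilt :: "('k::real_or_complex, 'a) nspace \<Rightarrow> ('a \<Rightarrow> real) \<Rightarrow> 'a \<Rightarrow> 'a \<Rightarrow> real" where
  "tilt V q y x =
     (if x \<in> carrier V then INF t\<in>{0..}. q (x \<oplus>\<^bsub>V\<^esub> of_real t \<odot>\<^bsub>V\<^esub> y) - t * q y else 0)"

context normed begin

lemma sublinearD:
  assumes "sublinear V q"
  shows sublinear_add: "\<lbrakk>x \<in> carrier V; y \<in> carrier V\<rbrakk> \<Longrightarrow> q (x \<oplus> y) \<le> q x + q y"
    and sublinear_zero: "q \<zero> = 0"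
    and sublinear_smult: "\<lbrakk>0 \<le> t; x \<in> carrier V\<rbrakk> \<Longrightarrow> q (of_real t \<odot> x) = t * q x"
    and sublinear_minus: "x \<in> carrier V \<Longrightarrow> - q ((- 1) \<odot> x) \<le> q x"
    and sublinear_outside: "x \<notin> carrier V \<Longrightarrow> q x = 0"
proof -
  note q = assms[unfolded sublinear_def]
  show add: "q (x \<oplus> y) \<le> q x + q y" if "x \<in> carrier V" "y \<in> carrier V" for x y
    using q that by blast
  have le: "q (of_real t \<odot> x) \<le> t * q x" if "0 < t" "x \<in> carrier V" for t x
    using q that by blast
  show zero: "q \<zero> = 0"
    using le[of "1/2" \<zero>] le[of 2 \<zero>] by simp
  show "q (of_real t \<odot> x) = t * q x" if "0 \<le> t" "x \<in> carrier V"
  proof (cases "t = 0")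
    case True
    then show ?thesis using that zero by simp
  next
    case False
    with that have "0 < t" by simp
    have "q x \<le> inverse t * q (of_real t \<odot> x)"
      using le[of "inverse t" "of_real t \<odot> x"] that \<open>0 < t\<close> by simp
    then show ?thesis
      using le[of t x] that \<open>0 < t\<close> by (simp add: field_simps)
  qed
  show "- q ((- 1) \<odot> x) \<le> q x" if "x \<in> carrier V"
    using add[of "(- 1) \<odot> x" x] smult_add_left[of x "- 1" 1] that zero by simp
  show "q x = 0" if "x \<notin> carrier V"
    using q that by blast
qed

text \<open>The infimum is finite because \<open>t q(y) = q(t y) \<le> q(x + t y) + q(- x)\<close> bounds its terms below by
  \<open>- q(- x)\<close>. Subadditivity and homogeneity come from choosing the parameters \<open>t + t'\<close> and
  \<open>s t\<close>; the two upper bounds are the parameters \<open>0\<close> and \<open>1\<close>.\<close>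

lemma
  assumes q: "sublinear V q" and y: "y \<in> carrier V"
  shows sublinear_tilt: "sublinear V (tilt V q y)"
    and tilt_le: "tilt V q y x \<le> q x"
    and tilt_le_minus: "x \<in> carrier V \<Longrightarrow> tilt V q y x \<le> q (x \<oplus> y) - q y"
proof -
  let ?f = "\<lambda>x t. q (x \<oplus> of_real t \<odot> y) - t * q y"
  have lower: "- q ((- 1) \<odot> x) \<le> ?f x t" if "x \<in> carrier V" "0 \<le> t" for x t
  proof -
    have "(x \<oplus> of_real t \<odot> y) \<oplus> (- 1) \<odot> x = of_real t \<odot> y \<oplus> ((- 1) \<odot> x \<oplus> x)"
      using that y by (simp add: add_assoc add_comm add_left_comm)
    also have "\<dots> = of_real t \<odot> y"
      using smult_add_left[of x "- 1" 1, symmetric] that y by simp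
    finally have "t * q y \<le> q (x \<oplus> of_real t \<odot> y) + q ((- 1) \<odot> x)"
      using sublinear_add[OF q, of "x \<oplus> of_real t \<odot> y" "(- 1) \<odot> x"] that y
      by (simp add: sublinear_smult[OF q])
    then show ?thesis by simp
  qed
  have upper: "tilt V q y x \<le> ?f x t" if "x \<in> carrier V" "0 \<le> t" for x t
    using that lower[OF that(1)] by (auto simp: tilt_def intro!: cINF_lower bdd_belowI2)
  have greatest: "c \<le> tilt V q y x" if "x \<in> carrier V" "\<And>t. 0 \<le> t \<Longrightarrow> c \<le> ?f x t" for c x
    using that by (auto simp: tilt_def intro!: cINF_greatest)
  show "tilt V q y x \<le> q x"
    using upper[of x 0] y by (cases "x \<in> carrier V") (simp_all add: tilt_def sublinear_outside[OF q])
  show "tilt V q y x \<le> q (x \<oplus> y) - q y" if "x \<in> carrier V"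
    using upper[of x 1] y that by simp
  have add: "tilt V q y (x \<oplus> x') \<le> tilt V q y x + tilt V q y x'"
    if x: "x \<in> carrier V" and x': "x' \<in> carrier V" for x x'
  proof -
    have *: "tilt V q y (x \<oplus> x') \<le> ?f x t + ?f x' t'" if "0 \<le> t" "0 \<le> t'" for t t'
    proof -
      have "x \<oplus> x' \<oplus> of_real (t + t') \<odot> y = (x \<oplus> of_real t \<odot> y) \<oplus> (x' \<oplus> of_real t' \<odot> y)"
        using x x' y by (simp add: smult_add_left add_assoc add_left_comm)
      then show ?thesis
        using upper[of "x \<oplus> x'" "t + t'"] x x' y that
          sublinear_add[OF q, of "x \<oplus> of_real t \<odot> y" "x' \<oplus> of_real t' \<odot> y"]
        by (simp add: algebra_simps)
    qed
    have "tilt V q y (x \<oplus> x') - ?f x t \<le> tilt V q y x'" if "0 \<le> t" for t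
      using *[OF that] by (intro greatest x') (simp add: algebra_simps)
    then have "tilt V q y (x \<oplus> x') - tilt V q y x' \<le> tilt V q y x"
      by (intro greatest x) (simp add: algebra_simps)
    then show ?thesis by simp
  qed
  have smult: "tilt V q y (of_real s \<odot> x) \<le> s * tilt V q y x"
    if "0 < s" and x: "x \<in> carrier V" for s x
  proof -
    have "tilt V q y (of_real s \<odot> x) / s \<le> ?f x t" if "0 \<le> t" for t
    proof -
      have "of_real s \<odot> x \<oplus> of_real (s * t) \<odot> y = of_real s \<odot> (x \<oplus> of_real t \<odot> y)"
        using x y by (simp add: smult_add_right)
      then have "tilt V q y (of_real s \<odot> x) \<le> s * q (x \<oplus> of_real t \<odot> y) - s * t * q y"
        using upper[of "of_real s \<odot> x" "s * t"] x y that \<open>0 < s\<close>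
        by (simp add: sublinear_smult[OF q])
      then show ?thesis
        using \<open>0 < s\<close> by (simp add: field_simps)
    qed
    then have "tilt V q y (of_real s \<odot> x) / s \<le> tilt V q y x"
      by (intro greatest x)
    then show ?thesis
      using \<open>0 < s\<close> by (simp add: field_simps)
  qed
  show "sublinear V (tilt V q y)"
    unfolding sublinear_def using add smult by (auto simp: tilt_def)
qed

text \<open>A chain has its pointwise infimum as a lower bound. It is finite since every sublinear \<open>r \<le> p\<close>
  satisfies \<open>r(x) \<ge> - r(- x) \<ge> - p(- x)\<close>, and subadditive since of two members of the chain the smaller
  one may be used for both summands.\<close>

lemma ex_minimal_sublinear:
  assumes p: "sublinear V p"
  obtains q where "sublinear V q" "q \<le> p" "\<And>r. \<lbrakk>sublinear V r; r \<le> q\<rbrakk> \<Longrightarrow> r = q"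
proof -
  define A where "A = {q. sublinear V q \<and> q \<le> p}"
  have "\<exists>m\<in>A. \<forall>a\<in>A. m \<ge> a \<longrightarrow> a = m"
  proof (rule predicate_Zorn)
    show "partial_order_on A (relation_of (\<ge>) A)"
      by (rule partial_order_on_relation_ofI) auto
  next
    fix C assume "C \<in> Chains (relation_of (\<ge>) A)"
    then have C: "C \<subseteq> A" and chain: "\<And>a b. \<lbrakk>a \<in> C; b \<in> C\<rbrakk> \<Longrightarrow> a \<le> b \<or> b \<le> a"
      by (auto simp: Chains_def relation_of_def)
    show "\<exists>u\<in>A. \<forall>a\<in>C. a \<ge> u"
    proof (cases "C = {}")
      case True
      then show ?thesis using p by (auto simp: A_def)
    next
      case False
      define u where "u = (\<lambda>x. INF q\<in>C. q x)"
      have sub: "sublinear V q" "q \<le> p" if "q \<in> C" for q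
        using C that by (auto simp: A_def)
      have upper: "u x \<le> q x" if "q \<in> C" for q x
      proof -
        have "min 0 (- p ((- 1) \<odot> x)) \<le> r x" if "r \<in> C" for r
        proof (cases "x \<in> carrier V")
          case True
          have "r ((- 1) \<odot> x) \<le> p ((- 1) \<odot> x)"
            using sub[OF that] by (simp add: le_fun_def)
          then show ?thesis
            using sublinear_minus[OF sub(1)[OF that] True] by simp
        next
          case False
          then show ?thesis
            by (simp add: sublinear_outside[OF sub(1)[OF that]])
        qed
        then show ?thesis
          unfolding u_def using that by (intro cINF_lower bdd_belowI2)
      qed
      have greatest: "c \<le> u x" if "\<And>q. q \<in> C \<Longrightarrow> c \<le> q x" for c x
        unfolding u_def using False that by (intro cINF_greatest)
      have "u (x \<oplus> y) \<le> u x + u y" if x: "x \<in> carrier V" and y: "y \<in> carrier V" for x y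
      proof -
        have *: "u (x \<oplus> y) \<le> q x + r y" if qr: "q \<in> C" "r \<in> C" for q r
        proof -
          obtain m where m: "m \<in> C" "m \<le> q" "m \<le> r"
            using chain[OF qr] qr by blast
          have "u (x \<oplus> y) \<le> m x + m y"
            using upper[OF m(1), of "x \<oplus> y"] sublinear_add[OF sub(1)[OF m(1)] x y] by linarith
          also have "\<dots> \<le> q x + r y"
            using m by (intro add_mono) (auto simp: le_fun_def)
          finally show ?thesis .
        qed
        have "u (x \<oplus> y) - q x \<le> u y" if "q \<in> C" for q
          using *[OF that] by (intro greatest) (simp add: algebra_simps)
        then have "u (x \<oplus> y) - u y \<le> u x"
          by (intro greatest) (simp add: algebra_simps)
        then show ?thesis by simp
      qed
      moreover have "u (of_real t \<odot> x) \<le> t * u x" if "0 < t" and x: "x \<in> carrier V" for t x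
      proof -
        have "u (of_real t \<odot> x) / t \<le> q x" if "q \<in> C" for q
          using upper[OF that, of "of_real t \<odot> x"] sublinear_smult[OF sub(1)[OF that], of t x] x \<open>0 < t\<close>
          by (simp add: field_simps)
        then have "u (of_real t \<odot> x) / t \<le> u x"
          by (rule greatest)
        then show ?thesis
          using \<open>0 < t\<close> by (simp add: field_simps)
      qed
      moreover have "u x = 0" if "x \<notin> carrier V" for x
        using False upper[of _ x] greatest[of 0 x] sublinear_outside[OF sub(1) that] by force
      ultimately have "sublinear V u"
        by (simp add: sublinear_def)
      moreover have "u \<le> p"
        using False upper sub(2) unfolding le_fun_def by (meson ex_in_conv order_trans)
      ultimately show ?thesis
        using upper by (auto simp: A_def le_fun_def)
    qed
  qed
  then obtain q where q: "q \<in> A" "\<And>r. \<lbrakk>r \<in> A; r \<le> q\<rbrakk> \<Longrightarrow> r = q"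
    by blast
  show thesis
  proof
    show "sublinear V q" "q \<le> p"
      using q(1) by (auto simp: A_def)
    show "r = q" if "sublinear V r" "r \<le> q" for r
      using q(1) that by (intro q(2)) (auto simp: A_def)
  qed
qed

text \<open>Take a minimal sublinear \<open>f\<close> below the norm tilted towards \<open>x0\<close>. Being equal to its tilt towards
  \<open>y\<close>, it satisfies \<open>f(x) \<le> f(x + y) - f(y)\<close>, so it is additive; and
  \<open>f(- x0) \<le> \<parallel>- x0 + x0\<parallel> - \<parallel>x0\<parallel> = - \<parallel>x0\<parallel>\<close> gives its value at \<open>x0\<close>.\<close>

lemma ex_real_linear_le_nrm:
  assumes x0: "x0 \<in> carrier V"
  obtains f :: "'a \<Rightarrow> real"
  where "\<And>x y. \<lbrakk>x \<in> carrier V; y \<in> carrier V\<rbrakk> \<Longrightarrow> f (x \<oplus> y) = f x + f y"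
    and "\<And>t x. x \<in> carrier V \<Longrightarrow> f (of_real t \<odot> x) = t * f x"
    and "\<And>x. x \<in> carrier V \<Longrightarrow> \<bar>f x\<bar> \<le> nrm V x"
    and "f x0 = nrm V x0"
proof -
  define p where "p = (\<lambda>x. if x \<in> carrier V then nrm V x else 0)"
  have p: "sublinear V p"
    by (auto simp: sublinear_def p_def nrm_triangle nrm_smult)
  obtain f where f: "sublinear V f" "f \<le> tilt V p x0"
    and minimal: "\<And>r. \<lbrakk>sublinear V r; r \<le> f\<rbrakk> \<Longrightarrow> r = f"
    using ex_minimal_sublinear[OF sublinear_tilt[OF p x0]] by blast
  have neg0: "(- 1) \<odot> x \<oplus> x = \<zero>" if "x \<in> carrier V" for x
    using smult_add_left[of x "- 1" 1] that by simp
  have add: "f (x \<oplus> y) = f x + f y" if x: "x \<in> carrier V" and y: "y \<in> carrier V" for x y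
  proof (rule antisym)
    show "f (x \<oplus> y) \<le> f x + f y"
      using sublinear_add[OF f(1) x y] .
    have "tilt V f y = f"
      using tilt_le[OF f(1) y] by (intro minimal sublinear_tilt f(1) y) (simp add: le_fun_def)
    then show "f x + f y \<le> f (x \<oplus> y)"
      using tilt_le_minus[OF f(1) y x] by simp
  qed
  have neg: "f ((- 1) \<odot> x) = - f x" if "x \<in> carrier V" for x
    using add[of "(- 1) \<odot> x" x] that neg0[OF that] sublinear_zero[OF f(1)] by simp
  have le: "f x \<le> nrm V x" if "x \<in> carrier V" for x
    using f(2) tilt_le[OF p x0, of x] that by (auto simp: le_fun_def p_def intro: order_trans)
  show thesis
  proof
    show "f (x \<oplus> y) = f x + f y" if "x \<in> carrier V" "y \<in> carrier V" for x y
      using that by (rule add)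
    show "f (of_real t \<odot> x) = t * f x" if "x \<in> carrier V" for t x
    proof (cases "0 \<le> t")
      case True
      then show ?thesis
        using that by (rule sublinear_smult[OF f(1)])
    next
      case False
      then have "f ((- 1) \<odot> (of_real (- t) \<odot> x)) = - (- t * f x)"
        using that by (subst neg) (simp_all only: smult_closed sublinear_smult[OF f(1)])
      then show ?thesis
        using that by simp
    qed
    show "\<bar>f x\<bar> \<le> nrm V x" if "x \<in> carrier V" for x
      using le[OF that] le[of "(- 1) \<odot> x"] neg[OF that] that by (simp add: nrm_smult)
    have "f ((- 1) \<odot> x0) \<le> tilt V p x0 ((- 1) \<odot> x0)"
      using f(2) by (simp add: le_fun_def)
    also have "\<dots> \<le> - nrm V x0"
      using tilt_le_minus[OF p x0, of "(- 1) \<odot> x0"] x0 neg0[OF x0] by (simp add: p_def)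
    finally show "f x0 = nrm V x0"
      using neg[OF x0] le[OF x0] by simp
  qed
qed

text \<open>Over \<open>\<real>\<close> the real-linear functional \<open>f\<close> of the previous lemma is itself a functional. Over \<open>\<complex>\<close> it
  is the real part of the complex-linear \<open>x \<mapsto> f(x) - i f(i x)\<close>. As only boundedness matters here,
  the crude constant \<open>2\<close> is enough.\<close>

lemma dual_separates_points:
  assumes x0: "x0 \<in> carrier V" "x0 \<noteq> \<zero>"
  obtains \<phi> where "\<phi> \<in> carrier (dual V)" "\<phi> x0 \<noteq> 0"
proof -
  obtain f :: "'a \<Rightarrow> real" where add: "\<And>x y. \<lbrakk>x \<in> carrier V; y \<in> carrier V\<rbrakk> \<Longrightarrow> f (x \<oplus> y) = f x + f y"
    and smult: "\<And>t x. x \<in> carrier V \<Longrightarrow> f (of_real t \<odot> x) = t * f x"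
    and le: "\<And>x. x \<in> carrier V \<Longrightarrow> \<bar>f x\<bar> \<le> nrm V x"
    and "f x0 = nrm V x0"
    using ex_real_linear_le_nrm[OF x0(1)] by blast
  then have f0: "f x0 \<noteq> 0"
    using x0 by (simp add: nrm_eq_0)
  consider "\<forall>z::'k. \<exists>a. z = a *\<^sub>R 1"
    | i :: 'k where "i * i = - 1"
      "\<forall>z. \<exists>a b. z = a *\<^sub>R 1 + b *\<^sub>R i \<and> norm z = sqrt (a\<^sup>2 + b\<^sup>2)"
    using real_or_complex by blast
  then show thesis
  proof cases
    case 1
    define \<phi> :: "'a \<Rightarrow> 'k" where "\<phi> x = (if x \<in> carrier V then of_real (f x) else 0)" for x
    show thesis
    proof
      show "\<phi> \<in> carrier (dual V)"
      proof (rule dual_carrierI[where C = 1])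
        show "\<phi> (c \<odot> x) = c * \<phi> x" if "x \<in> carrier V" for c x
        proof -
          obtain a where "c = of_real a"
            using 1 by (auto simp: of_real_def)
          then show ?thesis
            using that by (simp add: \<phi>_def smult)
        qed
      qed (auto simp: \<phi>_def add le)
      show "\<phi> x0 \<noteq> 0"
        using x0 f0 by (simp add: \<phi>_def)
    qed
  next
    case (2 i)
    have i: "norm i = 1"
    proof -
      have "norm i * norm i = 1"
        using 2(1) by (metis norm_mult norm_minus_cancel norm_one)
      then show ?thesis
        by (metis abs_norm_cancel abs_mult_self_eq mult.commute power2_eq_square real_sqrt_abs2 real_sqrt_one)
    qed
    define \<phi> :: "'a \<Rightarrow> 'k" where
      "\<phi> x = (if x \<in> carrier V then of_real (f x) - i * of_real (f (i \<odot> x)) else 0)" for x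
    show thesis
    proof
      show "\<phi> \<in> carrier (dual V)"
      proof (rule dual_carrierI[where C = 2])
        show "\<phi> (x \<oplus> y) = \<phi> x + \<phi> y" if "x \<in> carrier V" "y \<in> carrier V" for x y
          using that by (simp add: \<phi>_def add smult_add_right algebra_simps)
        show "\<phi> (c \<odot> x) = c * \<phi> x" if x: "x \<in> carrier V" for c x
        proof -
          obtain a b where c: "c = of_real a + of_real b * i"
            using 2(2) by (force simp: scaleR_conv_of_real)
          have f1: "f (c \<odot> x) = a * f x + b * f (i \<odot> x)"
            using smult[of "i \<odot> x" b] x by (simp add: c smult_add_left add smult)
          have ii: "i * (i * z) = - z" for z
            using 2(1) by (simp flip: mult.assoc)
          have "i * c = of_real a * i + of_real (- b)"
            by (simp add: c algebra_simps ii)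
          then have f2: "f (i \<odot> (c \<odot> x)) = a * f (i \<odot> x) - b * f x"
            using smult[of "i \<odot> x" a] smult[of x "- b"] x
            by (simp add: smult_add_left add del: of_real_minus)
          have "\<phi> (c \<odot> x) = of_real (a * f x + b * f (i \<odot> x))
              - i * of_real (a * f (i \<odot> x) - b * f x)"
            using x by (simp only: \<phi>_def f1 f2 smult_closed if_True)
          also have "\<dots> = c * \<phi> x"
            using x by (simp add: \<phi>_def c algebra_simps ii)
          finally show ?thesis .
        qed
        show "norm (\<phi> x) \<le> 2 * nrm V x" if "x \<in> carrier V" for x
          using norm_triangle_ineq4[of "of_real (f x)" "i * of_real (f (i \<odot> x))"]
            le[OF that] le[of "i \<odot> x"] that i
          by (simp add: \<phi>_def norm_mult nrm_smult)
      qed (simp add: \<phi>_def)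
      show "\<phi> x0 \<noteq> 0"
      proof
        assume "\<phi> x0 = 0"
        then have "of_real (f x0) = i * of_real (f (i \<odot> x0))"
          using x0 by (simp add: \<phi>_def)
        then have "of_real (f x0) * of_real (f x0)
            = (i * i) * (of_real (f (i \<odot> x0)) * of_real (f (i \<odot> x0)))"
          by (simp add: algebra_simps)
        then have "of_real (f x0 * f x0 + f (i \<odot> x0) * f (i \<odot> x0)) = (0 :: 'k)"
          using 2(1) by simp
        then have "f x0 * f x0 + f (i \<odot> x0) * f (i \<odot> x0) = 0"
          by (simp only: of_real_eq_0_iff)
        then show False
          using f0 by (simp add: sum_squares_eq_zero_iff)
      qed
    qed
  qed
qed

end


section \<open>Sequence classes on isometric copies\<close>

lemma class_at_simps:
  "carrier (class_at \<iota> X V) =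
     {s. (\<forall>n. s n \<in> carrier V) \<and> (\<lambda>n. \<iota> (s n)) \<in> carrier (X (copy \<iota> V))}"
  "nrm (class_at \<iota> X V) s = nrm (X (copy \<iota> V)) (\<lambda>n. \<iota> (s n))"
  "zero (class_at \<iota> X V) = (\<lambda>n. \<zero>\<^bsub>V\<^esub>)"
  "add (class_at \<iota> X V) = (\<lambda>s t n. s n \<oplus>\<^bsub>V\<^esub> t n)"
  "smult (class_at \<iota> X V) = (\<lambda>c s n. c \<odot>\<^bsub>V\<^esub> s n)"
  by (simp_all add: class_at_def sequence_space_def)

text \<open>The copy carries one-term sequences to one-term sequences, so the axioms of a sequence class on the
  copy give the corresponding facts on \<open>V\<close>.\<close>

lemma single_in_class_at:
  assumes X: "sequence_class X" and V: "banach_space V" and inj: "inj_on \<iota> (carrier V)"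
    and x: "x \<in> carrier V"
  shows "single V x j \<in> carrier (class_at \<iota> X V)"
    and "nrm (class_at \<iota> X V) (single V x j) = nrm V x"
proof -
  interpret normed V
    using V by (rule banach_normed)
  note c = copy_simps[OF inj]
  have image: "(\<lambda>n. \<iota> (single V x j n)) = single (copy \<iota> V) (\<iota> x) j"
    by (auto simp: single_def c fun_eq_iff)
  have class_V: "c00 (copy \<iota> V) \<subseteq> carrier (X (copy \<iota> V))"
    "\<forall>u\<in>carrier (copy \<iota> V). \<forall>j. nrm (X (copy \<iota> V)) (single (copy \<iota> V) u j) = nrm (copy \<iota> V) u"
    using X banach_copy[OF V inj] unfolding sequence_class_def by blast+
  have "single (copy \<iota> V) (\<iota> x) j \<in> c00 (copy \<iota> V)"
    using x by (auto simp: c00_def single_def c intro: rev_finite_subset[of "{j}"])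
  then have "(\<lambda>n. \<iota> (single V x j n)) \<in> carrier (X (copy \<iota> V))"
    unfolding image using class_V(1) by blast
  then show "single V x j \<in> carrier (class_at \<iota> X V)"
    using x by (simp add: class_at_simps) (simp add: single_def)
  show "nrm (class_at \<iota> X V) (single V x j) = nrm V x"
    unfolding class_at_simps image using class_V(2) x by (simp add: c)
qed

text \<open>Linear stability is applied to the operator that \<open>T\<close> induces between the copies of \<open>V\<close> and \<open>W\<close> in
  the universe; its norm equals that of the operator it induces on sequences.\<close>

lemma class_at_map:
  assumes X: "sequence_class X" "linearly_stable X"
    and V: "banach_space V" "inj_on \<iota> (carrier V)"
    and W: "banach_space W" "inj_on \<kappa> (carrier W)"
    and T: "bounded_linear_map V W T"
    and C: "\<And>x. x \<in> carrier V \<Longrightarrow> nrm W (T x) \<le> C * nrm V x" "0 \<le> C"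
    and s: "s \<in> carrier (class_at \<iota> X V)"
  shows "(\<lambda>n. T (s n)) \<in> carrier (class_at \<kappa> X W)"
    and "nrm (class_at \<kappa> X W) (\<lambda>n. T (s n)) \<le> C * nrm (class_at \<iota> X V) s"
proof -
  interpret V: normed V
    using V(1) by (rule banach_normed)
  let ?V = "copy \<iota> V" and ?W = "copy \<kappa> W"
  define T' where "T' u = \<kappa> (T (inv_into (carrier V) \<iota> u))" for u
  note c = copy_simps[OF V(2)] copy_simps[OF W(2)]
  have T_lin: "T x \<in> carrier W" "T (a \<odot>\<^bsub>V\<^esub> x) = a \<odot>\<^bsub>W\<^esub> T x"
    "y \<in> carrier V \<Longrightarrow> T (x \<oplus>\<^bsub>V\<^esub> y) = T x \<oplus>\<^bsub>W\<^esub> T y" if "x \<in> carrier V" for a x y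
    using T that by (auto simp: bounded_linear_map_def linear_map_def)
  have T': "T' (\<iota> x) = \<kappa> (T x)" if "x \<in> carrier V" for x
    using that V(2) by (simp add: T'_def)
  have bV: "banach_space ?V" and bW: "banach_space ?W"
    using banach_copy V W by blast+
  have T'_le: "nrm ?W (T' u) \<le> C * nrm ?V u" if "u \<in> carrier ?V" for u
    using that C(1) by (auto simp: c T' T_lin)
  have T'_bounded: "bounded_linear_map ?V ?W T'"
    unfolding bounded_linear_map_def
  proof
    show "linear_map ?V ?W T'"
      unfolding linear_map_def by (auto simp: c T' T_lin)
    show "\<exists>C. \<forall>x\<in>carrier ?V. nrm ?W (T' x) \<le> C * nrm ?V x"
      using T'_le by blast
  qed
  have hat: "\<forall>s\<in>carrier (X ?V). (\<lambda>n. T' (s n)) \<in> carrier (X ?W)"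
    "bounded_linear_map (X ?V) (X ?W) (\<lambda>s n. T' (s n))"
    "op_norm (X ?V) (X ?W) (\<lambda>s n. T' (s n)) = op_norm ?V ?W T'"
    using X(2) bV bW T'_bounded unfolding linearly_stable_def by blast+
  have nXV: "normed (X ?V)" and nXW: "normed (X ?W)"
    using X(1) bV bW unfolding sequence_class_def by (blast intro: banach_normed)+
  have s': "\<And>n. s n \<in> carrier V" "(\<lambda>n. \<iota> (s n)) \<in> carrier (X ?V)"
    using s by (auto simp: class_at_simps)
  have image: "(\<lambda>n. T' (\<iota> (s n))) = (\<lambda>n. \<kappa> (T (s n)))"
    using s'(1) by (simp add: T')
  show "(\<lambda>n. T (s n)) \<in> carrier (class_at \<kappa> X W)"
    using hat(1) s' T_lin(1) by (auto simp: class_at_simps simp flip: image)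
  have "nrm (class_at \<kappa> X W) (\<lambda>n. T (s n))
      \<le> op_norm ?V ?W T' * nrm (class_at \<iota> X V) s"
    using bounded_linear_map_le_op_norm[OF hat(2) nXV nXW s'(2)]
    by (simp add: class_at_simps image hat(3))
  also have "\<dots> \<le> C * nrm (class_at \<iota> X V) s"
    using op_norm_le[OF T'_le C(2) banach_normed[OF bV]] normed.nrm_nonneg[OF nXV s'(2)]
    by (intro mult_right_mono) (auto simp: class_at_simps)
  finally show "nrm (class_at \<kappa> X W) (\<lambda>n. T (s n)) \<le> C * nrm (class_at \<iota> X V) s" .
qed

text \<open>Evaluation at \<open>x\<close> is an operator from the dual into the scalars of norm at most \<open>\<parallel>x\<parallel>\<close>. This is how
  vector-valued sequences in \<open>X(E')\<close> become scalar sequences in \<open>X(K)\<close>, about which the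
  embedding hypotheses speak.\<close>

lemma class_at_eval:
  fixes E :: "('k::real_or_complex, 'a) nspace"
  assumes X: "sequence_class X" "linearly_stable X" and E: "normed E"
    and inj: "inj_on \<iota> (carrier (dual E))" "inj \<kappa>"
    and x: "x \<in> carrier E" and \<phi>: "\<phi> \<in> carrier (class_at \<iota> X (dual E))"
  shows "(\<lambda>n. \<phi> n x) \<in> carrier (class_at \<kappa> X (scalar_space :: ('k, 'k) nspace))"
    and "nrm (class_at \<kappa> X (scalar_space :: ('k, 'k) nspace)) (\<lambda>n. \<phi> n x)
           \<le> nrm E x * nrm (class_at \<iota> X (dual E)) \<phi>"
proof -
  interpret normed E by fact
  have le: "nrm (scalar_space :: ('k, 'k) nspace) (f x) \<le> nrm E x * nrm (dual E) f"
    if "f \<in> carrier (dual E)" for f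
    using dual_bound[OF that x] by (simp add: mult.commute)
  have bdd: "bounded_linear_map (dual E) (scalar_space :: ('k, 'k) nspace) (\<lambda>f. f x)"
    unfolding bounded_linear_map_def linear_map_def using le by auto
  note map = class_at_map[OF X banach_dual inj(1) banach_scalar_space _ bdd le nrm_nonneg[OF x] \<phi>]
  show "(\<lambda>n. \<phi> n x) \<in> carrier (class_at \<kappa> X (scalar_space :: ('k, 'k) nspace))"
    using inj(2) by (intro map) simp_all
  show "nrm (class_at \<kappa> X (scalar_space :: ('k, 'k) nspace)) (\<lambda>n. \<phi> n x)
      \<le> nrm E x * nrm (class_at \<iota> X (dual E)) \<phi>"
    using inj(2) by (intro map) simp_all
qed


section \<open>The pairing of a scalar sequence space with its dual\<close>

lemma scalar_sequence_spaceD: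
  fixes \<Lambda> :: "('k::real_or_complex, nat \<Rightarrow> 'k) nspace"
  assumes "scalar_sequence_space \<Lambda>"
  shows "normed \<Lambda>" and "unit_vec j \<in> carrier \<Lambda>"
    and "\<lbrakk>s \<in> carrier \<Lambda>; t \<in> carrier \<Lambda>\<rbrakk> \<Longrightarrow> s \<oplus>\<^bsub>\<Lambda>\<^esub> t = (\<lambda>n. s n + t n)"
    and "s \<in> carrier \<Lambda> \<Longrightarrow> c \<odot>\<^bsub>\<Lambda>\<^esub> s = (\<lambda>n. c * s n)"
    and "s \<in> carrier \<Lambda> \<Longrightarrow> norm (s n) \<le> nrm \<Lambda> s"
proof -
  note \<Lambda> = assms[unfolded scalar_sequence_space_def]
  show "normed \<Lambda>"
    using \<Lambda> by (blast intro: banach_normed)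
  show "unit_vec j \<in> carrier \<Lambda>"
    using \<Lambda> unfolding schauder_basis_def by blast
  show "s \<oplus>\<^bsub>\<Lambda>\<^esub> t = (\<lambda>n. s n + t n)" if "s \<in> carrier \<Lambda>" "t \<in> carrier \<Lambda>"
    using \<Lambda> that by (simp add: embeds1_def linf_def sequence_space_def)
  show "c \<odot>\<^bsub>\<Lambda>\<^esub> s = (\<lambda>n. c * s n)" if "s \<in> carrier \<Lambda>"
    using \<Lambda> that by (simp add: embeds1_def linf_def sequence_space_def)
  show "norm (s n) \<le> nrm \<Lambda> s" if "s \<in> carrier \<Lambda>"
  proof -
    have "s \<in> carrier (linf scalar_space)" "nrm (linf scalar_space) s \<le> nrm \<Lambda> s"
      using \<Lambda> that unfolding embeds1_def by blast+
    then have "bdd_above (range (\<lambda>n. norm (s n)))" "(SUP n. norm (s n)) \<le> nrm \<Lambda> s"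
      by (simp_all add: linf_def sequence_space_def)
    then show ?thesis
      by (meson UNIV_I cSUP_upper order_trans)
  qed
qed

text \<open>The Schauder expansion of \<open>s\<close> is mapped by \<open>f\<close> to a convergent scalar series, by continuity. Its
  coefficients are abstract at first; they are the entries of \<open>s\<close> because coordinate functionals are
  bounded on \<open>\<Lambda>\<close>, by \<open>\<Lambda> \<hookrightarrow> \<ell>\<^sub>\<infinity>\<close>.\<close>

lemma functional_expansion:
  fixes \<Lambda> :: "('k::real_or_complex, nat \<Rightarrow> 'k) nspace"
  assumes \<Lambda>: "scalar_sequence_space \<Lambda>" and f: "f \<in> carrier (dual \<Lambda>)" and s: "s \<in> carrier \<Lambda>"
  shows "(\<lambda>n. s n * f (unit_vec n)) sums f s"
proof -
  note D = scalar_sequence_spaceD[OF \<Lambda>]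
  interpret normed \<Lambda> by (rule D)
  interpret abelian_group \<Lambda> by (rule abelian_group)
  obtain a where
    a: "(\<lambda>n. nrm \<Lambda> (s \<ominus>\<^bsub>\<Lambda>\<^esub> finsum \<Lambda> (\<lambda>j. a j \<odot>\<^bsub>\<Lambda>\<^esub> unit_vec j) {..<n})) \<longlonglongrightarrow> 0"
    using \<Lambda> s unfolding scalar_sequence_space_def schauder_basis_def by blast
  define P where "P n = finsum \<Lambda> (\<lambda>j. a j \<odot>\<^bsub>\<Lambda>\<^esub> unit_vec j) {..<n}" for n
  have P: "P n \<in> carrier \<Lambda>" for n
    unfolding P_def by (intro finsum_closed Pi_I smult_closed D(2))
  have P_Suc: "P (Suc n) = a n \<odot>\<^bsub>\<Lambda>\<^esub> unit_vec n \<oplus>\<^bsub>\<Lambda>\<^esub> P n" for n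
    unfolding P_def lessThan_Suc by (rule finsum_insert) (auto intro: smult_closed D(2))
  have expansion: "(\<lambda>j. a j * g (unit_vec j)) sums g s" if g: "g \<in> carrier (dual \<Lambda>)" for g
  proof -
    have gP: "g (P n) = (\<Sum>j<n. a j * g (unit_vec j))" for n
    proof (induction n)
      case 0
      then show ?case
        using dual_carrierD(4)[OF g zero_closed, of 0] by (simp add: P_def)
    next
      case (Suc n)
      then show ?case
        by (simp add: P_Suc dual_carrierD(3,4)[OF g] P D(2))
    qed
    have le: "norm (g s - (\<Sum>j<n. a j * g (unit_vec j)))
        \<le> nrm (dual \<Lambda>) g * nrm \<Lambda> (s \<ominus>\<^bsub>\<Lambda>\<^esub> P n)" for n
      using dual_bound[OF g minus_closed[OF s P], of n] s P
      by (simp add: normed.minus_eq[OF D(1)] dual_carrierD(3,4)[OF g] gP)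
    have "(\<lambda>n. nrm (dual \<Lambda>) g * nrm \<Lambda> (s \<ominus>\<^bsub>\<Lambda>\<^esub> P n)) \<longlonglongrightarrow> 0"
      using tendsto_mult_left[OF a, of "nrm (dual \<Lambda>) g"] by (simp add: P_def)
    then have "(\<lambda>n. g s - (\<Sum>j<n. a j * g (unit_vec j))) \<longlonglongrightarrow> 0"
      by (rule Lim_null_comparison[OF always_eventually[OF allI[OF le]]])
    then have "(\<lambda>n. g s - (g s - (\<Sum>j<n. a j * g (unit_vec j)))) \<longlonglongrightarrow> g s - 0"
      by (intro tendsto_intros)
    then show ?thesis
      by (simp add: sums_def)
  qed
  \<comment> \<open>Applied to the coordinate functionals, the expansion identifies its coefficients.\<close>
  have "a k = s k" for k
  proof -
    let ?g = "\<lambda>t. if t \<in> carrier \<Lambda> then t k else 0"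
    have g: "?g \<in> carrier (dual \<Lambda>)"
    proof (rule dual_carrierI[where C = 1])
      show "?g (s \<oplus>\<^bsub>\<Lambda>\<^esub> t) = ?g s + ?g t" if "s \<in> carrier \<Lambda>" "t \<in> carrier \<Lambda>" for s t
        using that add_closed[OF that] D(3)[OF that] by simp
      show "?g (c \<odot>\<^bsub>\<Lambda>\<^esub> t) = c * ?g t" if "t \<in> carrier \<Lambda>" for c t
        using that smult_closed[OF that, of c] D(4)[OF that, of c] by simp
    qed (simp_all add: D(5))
    from expansion[OF g] have "(\<lambda>j. a j * (unit_vec j k :: 'k)) sums s k"
      using s by (simp add: D(2))
    moreover have "(\<lambda>j. a j * (unit_vec j k :: 'k)) = (\<lambda>j. if j = k then a j else 0)"
      by (auto simp: single_def)
    ultimately have "(\<lambda>j. if j = k then a j else 0) sums s k"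
      by simp
    then show ?thesis
      using sums_single[of k a] sums_unique2[of "\<lambda>j. if j = k then a j else 0"] by metis
  qed
  with expansion[OF f] show ?thesis
    by simp
qed

text \<open>By \<open>functional_expansion\<close> a functional on \<open>\<Lambda>\<close> is determined by its values on the unit vectors, which
  resolves the description operator in the norm of \<open>lower_star\<close>.\<close>

lemma lower_star_functional:
  fixes \<Lambda> :: "('k::real_or_complex, nat \<Rightarrow> 'k) nspace"
  assumes \<Lambda>: "scalar_sequence_space \<Lambda>" and b: "b \<in> carrier (lower_star \<Lambda>)"
  obtains f where "f \<in> carrier (dual \<Lambda>)" "b = (\<lambda>j. f (unit_vec j))"
    "nrm (dual \<Lambda>) f = nrm (lower_star \<Lambda>) b"
proof -
  obtain f where f: "f \<in> carrier (dual \<Lambda>)" "b = (\<lambda>j. f (unit_vec j))"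
    using b by (auto simp: lower_star_def sequence_space_def)
  have "g = f" if g: "g \<in> carrier (dual \<Lambda>)" "b = (\<lambda>j. g (unit_vec j))" for g
  proof
    fix s
    have eq: "g (unit_vec j) = f (unit_vec j)" for j
      using f(2) g(2) by metis
    show "g s = f s"
    proof (cases "s \<in> carrier \<Lambda>")
      case True
      then show ?thesis
        using sums_unique2[OF functional_expansion[OF \<Lambda> g(1) True, unfolded eq]
            functional_expansion[OF \<Lambda> f(1) True]] by simp
    next
      case False
      then show ?thesis
        using dual_carrierD(2) f(1) g(1) by metis
    qed
  qed
  then have "(THE g. g \<in> carrier (dual \<Lambda>) \<and> b = (\<lambda>j. g (unit_vec j))) = f"
    by (intro the_equality conjI f) (elim conjE)
  then have "nrm (dual \<Lambda>) f = nrm (lower_star \<Lambda>) b"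
    by (simp add: lower_star_def sequence_space_def)
  with f show thesis
    by (rule that)
qed

text \<open>The series is the value at \<open>a\<close> of the functional that represents \<open>b\<close>.\<close>

lemma lower_star_pairing:
  fixes \<Lambda> :: "('k::real_or_complex, nat \<Rightarrow> 'k) nspace"
  assumes \<Lambda>: "scalar_sequence_space \<Lambda>"
    and a: "a \<in> carrier \<Lambda>" and b: "b \<in> carrier (lower_star \<Lambda>)"
  shows "summable (\<lambda>n. a n * b n)"
    and "norm (\<Sum>n. a n * b n) \<le> nrm \<Lambda> a * nrm (lower_star \<Lambda>) b"
proof -
  obtain f where f: "f \<in> carrier (dual \<Lambda>)" "b = (\<lambda>j. f (unit_vec j))"
    "nrm (dual \<Lambda>) f = nrm (lower_star \<Lambda>) b"
    by (rule lower_star_functional[OF \<Lambda> b])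
  have sums: "(\<lambda>n. a n * b n) sums f a"
    using functional_expansion[OF \<Lambda> f(1) a] f(2) by simp
  then show "summable (\<lambda>n. a n * b n)"
    by (rule sums_summable)
  have "(\<Sum>n. a n * b n) = f a"
    using sums by (rule sums_unique[symmetric])
  then show "norm (\<Sum>n. a n * b n) \<le> nrm \<Lambda> a * nrm (lower_star \<Lambda>) b"
    using normed.dual_bound[OF scalar_sequence_spaceD(1)[OF \<Lambda>] f(1) a]
    by (simp add: f(3)[simplified] mult.commute)
qed


section \<open>Tensors and functionals\<close>

lemma bilinear_formsD:
  assumes "A \<in> bilinear_forms E F" and "x \<in> carrier E" and "y \<in> carrier F"
  shows "z \<in> carrier E \<Longrightarrow> A (x \<oplus>\<^bsub>E\<^esub> z) y = A x y + A z y"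
    and "A (c \<odot>\<^bsub>E\<^esub> x) y = c * A x y"
    and "linear_map F scalar_space (A x)"
  using assms by (auto simp: bilinear_forms_def linear_map_def)

lemma tensor_sum_eval:
  "A \<in> bilinear_forms E F \<Longrightarrow> tensor_sum E F k x y A = (\<Sum>j<k. A (x j) (y j))"
  "A \<notin> bilinear_forms E F \<Longrightarrow> tensor_sum E F k x y A = 0"
  by (simp_all add: tensor_sum_def elem_tensor_def)

text \<open>The vector is \<open>\<Sum>j<k. c j \<cdot> y j\<close>. Describing it through its values under linear functionals
  turns sums in the carrier into sums of scalars.\<close>

lemma (in normed) ex_linear_combination:
  fixes k :: nat
  assumes "\<forall>j<k. y j \<in> carrier V"
  shows "\<exists>v\<in>carrier V. \<forall>g. linear_map V scalar_space g \<longrightarrow> g v = (\<Sum>j<k. c j * g (y j))"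
  using assms
proof (induction k)
  case 0
  have "g \<zero> = 0" if "linear_map V scalar_space g" for g :: "'a \<Rightarrow> 'k"
  proof -
    have "g (0 \<odot> \<zero>) = 0 * g \<zero>"
      using that zero_closed unfolding linear_map_def by (metis scalar_space_simps(6))
    then show ?thesis by simp
  qed
  then show ?case
    by (intro bexI[of _ "\<zero>"]) auto
next
  case (Suc k)
  then obtain v where v: "v \<in> carrier V"
    "\<forall>g. linear_map V scalar_space g \<longrightarrow> g v = (\<Sum>j<k. c j * g (y j))"
    by auto
  have "y k \<in> carrier V"
    using Suc.prems by simp
  then show ?case
    using v by (intro bexI[of _ "v \<oplus> c k \<odot> y k"]) (auto simp: linear_map_def)
qed

text \<open>Induction on the number of terms, by eliminating the last one. If \<open>x k \<noteq> 0\<close>, choose a bounded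
  \<open>\<phi>0\<close> with \<open>\<phi>0(x k) = 1\<close>. The hypothesis for \<open>\<phi>0\<close> says that every linear functional, in
  particular \<open>A(x k, \<cdot>)\<close>, sees \<open>y k\<close> as \<open>- \<Sum>j<k. \<phi>0(x j) \<cdot> y j\<close>. Hence
  \<open>\<Sum>j<k. z j \<otimes> y j\<close> with \<open>z j = x j - \<phi>0(x j) \<cdot> x k\<close> represents the same tensor with one
  term less and inherits the hypothesis. Allowing arbitrary, also unbounded, linear \<open>g\<close> on \<open>F\<close>
  is what makes this substitution possible, since the partial maps of \<open>A\<close> need not be bounded.\<close>

lemma bilinear_sum_eq_0_of_left_dual:
  fixes E :: "('k::real_or_complex, 'a) nspace" and F :: "('k, 'b) nspace" and k :: nat
  assumes E: "normed E"
    and "\<forall>j<k. x j \<in> carrier E \<and> y j \<in> carrier F"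
    and "\<And>\<phi> g. \<lbrakk>\<phi> \<in> carrier (dual E); linear_map F scalar_space g\<rbrakk> \<Longrightarrow>
           (\<Sum>j<k. \<phi> (x j) * g (y j)) = 0"
    and A: "A \<in> bilinear_forms E F"
  shows "(\<Sum>j<k. A (x j) (y j)) = 0"
  using assms(2,3)
proof (induction k arbitrary: x)
  case 0
  then show ?case by simp
next
  case (Suc k)
  interpret normed E by fact
  note D = bilinear_formsD[OF A]
  have xk: "x k \<in> carrier E" and yk: "y k \<in> carrier F"
    and x: "\<And>j. j < k \<Longrightarrow> x j \<in> carrier E" and y: "\<And>j. j < k \<Longrightarrow> y j \<in> carrier F"
    using Suc.prems(1) by simp_all
  show ?case
  proof (cases "x k = \<zero>\<^bsub>E\<^esub>")
    case True
    have "\<phi> \<zero>\<^bsub>E\<^esub> = 0" if "\<phi> \<in> carrier (dual E)" for \<phi>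
      using dual_carrierD(4)[OF that zero_closed, of 0] by simp
    then have "(\<Sum>j<k. A (x j) (y j)) = 0"
      using Suc.prems True by (intro Suc.IH) force+
    moreover have "A \<zero>\<^bsub>E\<^esub> (y k) = 0"
      using D(2)[OF zero_closed yk, of 0] by simp
    ultimately show ?thesis
      by (simp add: True)
  next
    case False
    obtain \<phi>' where "\<phi>' \<in> carrier (dual E)" "\<phi>' (x k) \<noteq> 0"
      by (rule dual_separates_points[OF xk False])
    then obtain \<phi>0 where \<phi>0: "\<phi>0 \<in> carrier (dual E)" and 1: "\<phi>0 (x k) = 1"
      using normed.smult_closed[OF normed_dual, of \<phi>' "inverse (\<phi>' (x k))"] by force
    define z where "z j = x j \<oplus>\<^bsub>E\<^esub> (- \<phi>0 (x j)) \<odot>\<^bsub>E\<^esub> x k" for j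
    have elim: "g (y k) = - (\<Sum>j<k. \<phi>0 (x j) * g (y j))" if "linear_map F scalar_space g" for g
      using Suc.prems(2)[OF \<phi>0 that] 1 by (simp add: add_eq_0_iff2)
    have "(\<Sum>j<k. A (z j) (y j)) = 0"
    proof (rule Suc.IH)
      show "\<forall>j<k. z j \<in> carrier E \<and> y j \<in> carrier F"
        using x xk y by (simp add: z_def)
      fix \<phi> and g :: "'b \<Rightarrow> 'k"
      assume \<phi>: "\<phi> \<in> carrier (dual E)" and g: "linear_map F scalar_space g"
      have "(\<Sum>j<k. \<phi> (z j) * g (y j))
          = (\<Sum>j<k. \<phi> (x j) * g (y j)) - \<phi> (x k) * (\<Sum>j<k. \<phi>0 (x j) * g (y j))"
        using x xk dual_carrierD(3,4)[OF \<phi>]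
        by (simp add: z_def algebra_simps sum_subtractf sum_distrib_left)
      also have "\<dots> = 0"
        using Suc.prems(2)[OF \<phi> g] elim[OF g] by simp
      finally show "(\<Sum>j<k. \<phi> (z j) * g (y j)) = 0" .
    qed
    moreover have "(\<Sum>j<k. A (z j) (y j))
        = (\<Sum>j<k. A (x j) (y j)) - (\<Sum>j<k. \<phi>0 (x j) * A (x k) (y j))"
      using x xk y by (simp add: z_def D sum_subtractf)
    ultimately show ?thesis
      using elim[OF D(3)[OF xk yk]] by simp
  qed
qed

text \<open>Bounded functionals on \<open>F\<close> separate points, so for every \<open>\<phi>\<close> the vector \<open>\<Sum>j<k. \<phi>(x j) \<cdot> y j\<close>
  vanishes; then algebraic functionals vanish on it too and the previous lemma applies.\<close>

lemma tensor_sum_eq_0: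
  fixes E :: "('k::real_or_complex, 'a) nspace" and F :: "('k, 'b) nspace"
  assumes E: "normed E" and F: "normed F"
    and xy: "\<forall>j<k. x j \<in> carrier E \<and> y j \<in> carrier F"
    and zero: "\<And>\<phi> \<psi>. \<lbrakk>\<phi> \<in> carrier (dual E); \<psi> \<in> carrier (dual F)\<rbrakk> \<Longrightarrow>
                 (\<Sum>j<k. \<phi> (x j) * \<psi> (y j)) = 0"
  shows "tensor_sum E F k x y = (\<lambda>A. 0)"
proof
  interpret F: normed F by fact
  have "(\<Sum>j<k. \<phi> (x j) * g (y j)) = 0"
    if \<phi>: "\<phi> \<in> carrier (dual E)" and g: "linear_map F scalar_space g" for \<phi> g
  proof -
    obtain v where v: "v \<in> carrier F"
      and gv: "\<And>g. linear_map F scalar_space g \<Longrightarrow> g v = (\<Sum>j<k. \<phi> (x j) * g (y j))"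
      using F.ex_linear_combination[of k y "\<lambda>j. \<phi> (x j)"] xy by auto
    have "v = \<zero>\<^bsub>F\<^esub>"
    proof (rule ccontr)
      assume "v \<noteq> \<zero>\<^bsub>F\<^esub>"
      then obtain \<psi> where \<psi>: "\<psi> \<in> carrier (dual F)" "\<psi> v \<noteq> 0"
        by (rule F.dual_separates_points[OF v])
      then show False
        using gv[of \<psi>] zero[OF \<phi> \<psi>(1)] dual_carrierD(1)[OF \<psi>(1)]
        by (simp add: bounded_linear_map_def)
    qed
    moreover have "g (0 \<odot>\<^bsub>F\<^esub> v) = 0 * g v"
      using g v unfolding linear_map_def by (metis scalar_space_simps(6))
    ultimately show ?thesis
      using gv[OF g] v by simp
  qed
  note left = bilinear_sum_eq_0_of_left_dual[OF E xy this]
  show "tensor_sum E F k x y A = 0" for A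
    using left[of A] by (cases "A \<in> bilinear_forms E F") (simp_all add: tensor_sum_eval)
qed

lemma tensor_space_simps [simp]:
  "zero (tensor_space E F \<alpha>) = (\<lambda>A. 0)" "add (tensor_space E F \<alpha>) = (\<lambda>u v A. u A + v A)"
  "smult (tensor_space E F \<alpha>) = (\<lambda>c u A. c * u A)" "nrm (tensor_space E F \<alpha>) = \<alpha>"
  by (simp_all add: tensor_space_def)

lemma tensor_space_carrier:
  "u \<in> carrier (tensor_space E F \<alpha>) \<longleftrightarrow>
     (\<exists>k x y. u = tensor_sum E F k x y \<and> (\<forall>j<k. x j \<in> carrier E \<and> y j \<in> carrier F))"
  by (auto simp: tensor_space_def)

lemma tensor_space_closed:
  fixes E :: "('k::real_or_complex, 'a) nspace"
  assumes E: "normed E"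
  shows "(\<lambda>A. 0) \<in> carrier (tensor_space E F \<alpha>)"
    and "\<lbrakk>u \<in> carrier (tensor_space E F \<alpha>); v \<in> carrier (tensor_space E F \<alpha>)\<rbrakk>
         \<Longrightarrow> (\<lambda>A. u A + v A) \<in> carrier (tensor_space E F \<alpha>)"
    and "u \<in> carrier (tensor_space E F \<alpha>) \<Longrightarrow> (\<lambda>A. c * u A) \<in> carrier (tensor_space E F \<alpha>)"
proof -
  interpret normed E by fact
  show "(\<lambda>A. 0) \<in> carrier (tensor_space E F \<alpha>)"
    unfolding tensor_space_carrier by (intro exI[of _ 0]) (simp add: tensor_sum_def)
  {
    assume "u \<in> carrier (tensor_space E F \<alpha>)" "v \<in> carrier (tensor_space E F \<alpha>)"
    then obtain k x y l x' y' where
      u: "u = tensor_sum E F k x y" "\<forall>j<k. x j \<in> carrier E \<and> y j \<in> carrier F" and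
      v: "v = tensor_sum E F l x' y'" "\<forall>j<l. x' j \<in> carrier E \<and> y' j \<in> carrier F"
      unfolding tensor_space_carrier by blast
    define x'' where "x'' j = (if j < k then x j else x' (j - k))" for j
    define y'' where "y'' j = (if j < k then y j else y' (j - k))" for j
    have split: "(\<Sum>j<k+l. h j) = (\<Sum>j<k. h j) + (\<Sum>j<l. h (k + j))" for h :: "nat \<Rightarrow> 'k"
      by (induction l) (simp_all add: add.assoc)
    have "(\<lambda>A. u A + v A) = tensor_sum E F (k + l) x'' y''"
      by (simp add: u v tensor_sum_def split x''_def y''_def fun_eq_iff)
    moreover have "\<forall>j<k+l. x'' j \<in> carrier E \<and> y'' j \<in> carrier F"
      using u(2) v(2) by (auto simp: x''_def y''_def)
    ultimately show "(\<lambda>A. u A + v A) \<in> carrier (tensor_space E F \<alpha>)"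
      unfolding tensor_space_carrier by blast
  }
  assume "u \<in> carrier (tensor_space E F \<alpha>)"
  then obtain k x y where
    u: "u = tensor_sum E F k x y" "\<forall>j<k. x j \<in> carrier E \<and> y j \<in> carrier F"
    unfolding tensor_space_carrier by blast
  have "c * u A = tensor_sum E F k (\<lambda>j. c \<odot>\<^bsub>E\<^esub> x j) y A" for A
  proof (cases "A \<in> bilinear_forms E F")
    case True
    then show ?thesis
      using u(2) by (simp add: u(1) tensor_sum_eval bilinear_formsD(2)[OF True] sum_distrib_left)
  qed (simp add: u(1) tensor_sum_eval)
  moreover have "\<forall>j<k. c \<odot>\<^bsub>E\<^esub> x j \<in> carrier E \<and> y j \<in> carrier F"
    using u(2) by simp
  ultimately show "(\<lambda>A. c * u A) \<in> carrier (tensor_space E F \<alpha>)"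
    unfolding tensor_space_carrier by blast
qed


section \<open>Crossnorms from sets of bilinear forms\<close>

text \<open>A tensor is a function on bilinear forms, so a supremum over a set of forms is independent of
  representations from the outset.\<close>

definition sup_over_forms :: "('a \<Rightarrow> 'b \<Rightarrow> 'k) set \<Rightarrow> ('k::real_or_complex, 'a, 'b) tensor \<Rightarrow> real" where
  "sup_over_forms \<B> u = (SUP B\<in>\<B>. norm (u B))"

text \<open>Contractivity of the forms makes the suprema finite and gives the upper crossnorm estimate.
  The products \<open>\<phi>(x) \<psi>(y)\<close> give, after normalising \<open>\<phi>\<close> and \<open>\<psi>\<close>, the dual
  estimate \<open>\<bar>(\<phi> \<otimes> \<psi>)(u)\<bar> \<le> \<parallel>\<phi>\<parallel> \<parallel>\<psi>\<parallel> \<alpha>(u)\<close>; if \<open>\<alpha>(u) = 0\<close>, this makes all products of functionals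
  vanish at \<open>u\<close>, whence \<open>u = 0\<close>. The other norm axioms hold for any supremum of moduli of
  linear evaluations.\<close>

lemma reasonable_crossnorm_sup_over_forms:
  fixes E :: "('k::real_or_complex, 'a) nspace" and F :: "('k, 'b) nspace"
  assumes E: "normed E" and F: "normed F"
    and forms: "\<B> \<subseteq> bilinear_forms E F"
    and contractive: "\<And>B x y. \<lbrakk>B \<in> \<B>; x \<in> carrier E; y \<in> carrier F\<rbrakk> \<Longrightarrow>
      norm (B x y) \<le> nrm E x * nrm F y"
    and products: "\<And>\<phi> \<psi>. \<lbrakk>\<phi> \<in> unit_ball (dual E); \<psi> \<in> unit_ball (dual F)\<rbrakk> \<Longrightarrow>
      (\<lambda>x y. \<phi> x * \<psi> y) \<in> \<B>"
  shows "reasonable_crossnorm E F (sup_over_forms \<B>)"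
    and "\<forall>j<k. x j \<in> carrier E \<and> y j \<in> carrier F \<Longrightarrow>
      bdd_above ((\<lambda>B. norm (tensor_sum E F k x y B)) ` \<B>)"
proof -
  interpret E: normed E by fact
  interpret F: normed F by fact
  interpret E': normed "dual E" by (rule E.normed_dual)
  interpret F': normed "dual F" by (rule F.normed_dual)
  let ?\<alpha> = "sup_over_forms \<B>"
  let ?T = "tensor_space E F ?\<alpha>"
  have nonempty: "\<B> \<noteq> {}"
    using products[of "\<lambda>x. 0" "\<lambda>y. 0"] E'.zero_closed E'.nrm_zero F'.zero_closed F'.nrm_zero
    by (auto simp: unit_ball_def)
  show bdd: "bdd_above ((\<lambda>B. norm (tensor_sum E F k x y B)) ` \<B>)"
    if "\<forall>j<k. x j \<in> carrier E \<and> y j \<in> carrier F" for k x y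
  proof (rule bdd_aboveI2)
    fix B assume B: "B \<in> \<B>"
    then have "tensor_sum E F k x y B = (\<Sum>j<k. B (x j) (y j))"
      using forms by (auto simp: tensor_sum_eval)
    then show "norm (tensor_sum E F k x y B) \<le> (\<Sum>j<k. nrm E (x j) * nrm F (y j))"
      using that by (auto intro!: sum_norm_le contractive B)
  qed
  have upper: "norm (u B) \<le> ?\<alpha> u" if "B \<in> \<B>" "u \<in> carrier ?T" for u B
    using that(2) unfolding tensor_space_carrier sup_over_forms_def
    by (auto intro!: cSUP_upper that(1) bdd)
  have least: "?\<alpha> u \<le> c" if "\<And>B. B \<in> \<B> \<Longrightarrow> norm (u B) \<le> c" for u c
    unfolding sup_over_forms_def using nonempty that by (rule cSUP_least)
  have nonneg: "0 \<le> ?\<alpha> u" if "u \<in> carrier ?T" for u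
    using nonempty upper[OF _ that] by (meson ex_in_conv norm_ge_zero order_trans)
  have product_le: "norm (tensor_functional \<phi> \<psi> u) \<le> nrm (dual E) \<phi> * nrm (dual F) \<psi> * ?\<alpha> u"
    if \<phi>: "\<phi> \<in> carrier (dual E)" and \<psi>: "\<psi> \<in> carrier (dual F)" and u: "u \<in> carrier ?T" for \<phi> \<psi> u
  proof -
    obtain k x y where u_eq: "u = tensor_sum E F k x y"
      using u unfolding tensor_space_carrier by blast
    note eval = tensor_functional_tensor_sum[of _ E _ F k x y, folded u_eq]
    show ?thesis
    proof (cases "nrm (dual E) \<phi> = 0 \<or> nrm (dual F) \<psi> = 0")
      case True
      then have "\<phi> = (\<lambda>x. 0) \<or> \<psi> = (\<lambda>y. 0)"
        using E'.nrm_eq_0[OF \<phi>] F'.nrm_eq_0[OF \<psi>] by auto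
      then have "tensor_functional \<phi> \<psi> u = 0"
        using eval[OF \<phi> \<psi>] by auto
      with True show ?thesis by auto
    next
      case False
      then have pos: "0 < nrm (dual E) \<phi>" "0 < nrm (dual F) \<psi>"
        using E'.nrm_nonneg[OF \<phi>] F'.nrm_nonneg[OF \<psi>] by auto
      let ?a = "of_real (inverse (nrm (dual E) \<phi>)) :: 'k"
      let ?b = "of_real (inverse (nrm (dual F) \<psi>)) :: 'k"
      have \<phi>': "(\<lambda>x. ?a * \<phi> x) \<in> unit_ball (dual E)"
        using E'.smult_closed[OF \<phi>, of ?a] E'.nrm_smult[OF \<phi>, of ?a] pos
        by (simp add: unit_ball_def norm_inverse)
      have \<psi>': "(\<lambda>y. ?b * \<psi> y) \<in> unit_ball (dual F)"
        using F'.smult_closed[OF \<psi>, of ?b] F'.nrm_smult[OF \<psi>, of ?b] pos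
        by (simp add: unit_ball_def norm_inverse)
      have "norm (tensor_functional (\<lambda>x. ?a * \<phi> x) (\<lambda>y. ?b * \<psi> y) u) \<le> ?\<alpha> u"
        using upper[OF products[OF \<phi>' \<psi>'] u] by (simp add: tensor_functional_def)
      moreover have "tensor_functional (\<lambda>x. ?a * \<phi> x) (\<lambda>y. ?b * \<psi> y) u
          = ?a * ?b * tensor_functional \<phi> \<psi> u"
        using eval[of "\<lambda>x. ?a * \<phi> x" "\<lambda>y. ?b * \<psi> y"] eval[OF \<phi> \<psi>] \<phi>' \<psi>'
        by (simp add: unit_ball_def sum_distrib_left ac_simps)
      ultimately have "inverse (nrm (dual E) \<phi>) * inverse (nrm (dual F) \<psi>)
          * norm (tensor_functional \<phi> \<psi> u) \<le> ?\<alpha> u"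
        using pos by (simp add: norm_mult norm_inverse)
      then show ?thesis
        using pos by (simp add: field_simps)
    qed
  qed
  have T: "normed_space ?T"
  proof (rule normed_spaceI)
    fix u assume u: "u \<in> carrier ?T"
    show smult: "c \<odot>\<^bsub>?T\<^esub> u \<in> carrier ?T" for c
      using tensor_space_closed(3)[OF E u] by simp
    show "0 \<le> nrm ?T u"
      using nonneg[OF u] by simp
    show "nrm ?T u = 0 \<longleftrightarrow> u = \<zero>\<^bsub>?T\<^esub>"
    proof
      assume "nrm ?T u = 0"
      then have zero: "tensor_functional \<phi> \<psi> u = 0"
        if "\<phi> \<in> carrier (dual E)" "\<psi> \<in> carrier (dual F)" for \<phi> \<psi>
        using product_le[OF that u] by simp
      obtain k x y where u_eq: "u = tensor_sum E F k x y"
        and xy: "\<forall>j<k. x j \<in> carrier E \<and> y j \<in> carrier F"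
        using u unfolding tensor_space_carrier by blast
      show "u = \<zero>\<^bsub>?T\<^esub>"
        using tensor_sum_eq_0[OF E F xy] zero
        by (simp add: u_eq tensor_functional_tensor_sum)
    next
      assume "u = \<zero>\<^bsub>?T\<^esub>"
      then show "nrm ?T u = 0"
        using least[of u 0] nonneg[OF u] by simp
    qed
    have le: "?\<alpha> (\<lambda>A. c * v A) \<le> norm c * ?\<alpha> v" if "v \<in> carrier ?T" for c v
      by (rule least) (simp add: norm_mult mult_left_mono upper that)
    show "nrm ?T (c \<odot>\<^bsub>?T\<^esub> u) = norm c * nrm ?T u" for c
    proof (cases "c = 0")
      case True
      then show ?thesis
        using le[OF u, of c] nonneg[OF smult[of c]] by simp
    next
      case False
      have "?\<alpha> u \<le> norm (inverse c) * ?\<alpha> (\<lambda>A. c * u A)"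
        using le[OF smult[of c], of "inverse c"] False by (simp flip: mult.assoc)
      then show ?thesis
        using le[OF u, of c] False by (simp add: norm_divide inverse_eq_divide field_simps)
    qed
    fix v assume v: "v \<in> carrier ?T"
    show "u \<oplus>\<^bsub>?T\<^esub> v \<in> carrier ?T"
      using tensor_space_closed(2)[OF E u v] by simp
    show "nrm ?T (u \<oplus>\<^bsub>?T\<^esub> v) \<le> nrm ?T u + nrm ?T v"
    proof (simp, rule least)
      fix B assume B: "B \<in> \<B>"
      show "norm (u B + v B) \<le> ?\<alpha> u + ?\<alpha> v"
        using norm_triangle_ineq[of "u B" "v B"] upper[OF B u] upper[OF B v] by linarith
    qed
  next
    show "\<zero>\<^bsub>?T\<^esub> \<in> carrier ?T"
      using tensor_space_closed(1)[OF E] by simp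
  qed (auto simp: fun_eq_iff algebra_simps)
  have "?\<alpha> (elem_tensor E F x y) \<le> nrm E x * nrm F y" if "x \<in> carrier E" "y \<in> carrier F" for x y
    using that forms contractive by (intro least) (auto simp: elem_tensor_def)
  moreover have "bounded_linear_map ?T scalar_space (tensor_functional \<phi> \<psi>)"
    if "\<phi> \<in> carrier (dual E)" "\<psi> \<in> carrier (dual F)" for \<phi> \<psi>
    using product_le[OF that]
    unfolding bounded_linear_map_def linear_map_def by (auto simp: tensor_functional_def)
  moreover have "op_norm ?T scalar_space (tensor_functional \<phi> \<psi>)
      \<le> nrm (dual E) \<phi> * nrm (dual F) \<psi>"
    if "\<phi> \<in> carrier (dual E)" "\<psi> \<in> carrier (dual F)" for \<phi> \<psi>
  proof (rule op_norm_le)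
    show "normed ?T"
      using T by (simp add: normed_def)
    show "0 \<le> nrm (dual E) \<phi> * nrm (dual F) \<psi>"
      using E'.nrm_nonneg F'.nrm_nonneg that by (intro mult_nonneg_nonneg)
  qed (use product_le[OF that] in simp)
  ultimately show "reasonable_crossnorm E F ?\<alpha>"
    unfolding reasonable_crossnorm_def using T by blast
qed


section \<open>The crossnorm of a scalar sequence space and two sequence classes\<close>

text \<open>Evaluating \<open>\<phi>\<close> at \<open>x\<close> and \<open>\<psi>\<close> at \<open>y\<close> gives elements of \<open>\<Lambda>\<close> and of its lower star, of norms at
  most \<open>\<parallel>x\<parallel>\<close> and \<open>\<parallel>y\<parallel>\<close>, which are then paired.\<close>

lemma class_at_pairing:
  fixes E :: "('k::real_or_complex, 'a) nspace" and F :: "('k, 'b) nspace"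
    and \<iota>K :: "'k \<Rightarrow> 'u"
  assumes E: "normed E" and F: "normed F"
    and \<Lambda>: "scalar_sequence_space \<Lambda>"
    and X: "sequence_class X" "linearly_stable X" and Y: "sequence_class Y" "linearly_stable Y"
    and inj: "inj \<iota>K" "inj_on \<iota>E (carrier (dual E))" "inj_on \<iota>F (carrier (dual F))"
    and embX: "embeds1 (class_at \<iota>K X scalar_space) \<Lambda>"
    and embY: "embeds1 (class_at \<iota>K Y scalar_space) (lower_star \<Lambda>)"
    and \<phi>: "\<phi> \<in> unit_ball (class_at \<iota>E X (dual E))"
    and \<psi>: "\<psi> \<in> unit_ball (class_at \<iota>F Y (dual F))"
    and x: "x \<in> carrier E" and y: "y \<in> carrier F"
  shows "summable (\<lambda>n. \<phi> n x * \<psi> n y)"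
    and "norm (\<Sum>n. \<phi> n x * \<psi> n y) \<le> nrm E x * nrm F y"
proof -
  interpret E: normed E by fact
  interpret F: normed F by fact
  have \<phi>': "\<phi> \<in> carrier (class_at \<iota>E X (dual E))" "nrm (class_at \<iota>E X (dual E)) \<phi> \<le> 1"
    and \<psi>': "\<psi> \<in> carrier (class_at \<iota>F Y (dual F))" "nrm (class_at \<iota>F Y (dual F)) \<psi> \<le> 1"
    using \<phi> \<psi> by (auto simp: unit_ball_def)
  note ex = class_at_eval[OF X E inj(2,1) x \<phi>'(1)]
  note ey = class_at_eval[OF Y F inj(3,1) y \<psi>'(1)]
  have a: "(\<lambda>n. \<phi> n x) \<in> carrier \<Lambda>"
    and b: "(\<lambda>n. \<psi> n y) \<in> carrier (lower_star \<Lambda>)"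
    using embX embY ex(1) ey(1) unfolding embeds1_def by blast+
  show "summable (\<lambda>n. \<phi> n x * \<psi> n y)"
    by (rule lower_star_pairing(1)[OF \<Lambda> a b])
  have "nrm \<Lambda> (\<lambda>n. \<phi> n x) \<le> nrm (class_at \<iota>K X scalar_space) (\<lambda>n. \<phi> n x)"
    using embX ex(1) unfolding embeds1_def by blast
  also have "\<dots> \<le> nrm E x * nrm (class_at \<iota>E X (dual E)) \<phi>"
    by (rule ex(2))
  also have "\<dots> \<le> nrm E x"
    using \<phi>'(2) x by (simp add: mult_left_le)
  finally have na: "nrm \<Lambda> (\<lambda>n. \<phi> n x) \<le> nrm E x" .
  have "nrm (lower_star \<Lambda>) (\<lambda>n. \<psi> n y) \<le> nrm (class_at \<iota>K Y scalar_space) (\<lambda>n. \<psi> n y)"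
    using embY ey(1) unfolding embeds1_def by blast
  also have "\<dots> \<le> nrm F y * nrm (class_at \<iota>F Y (dual F)) \<psi>"
    by (rule ey(2))
  also have "\<dots> \<le> nrm F y"
    using \<psi>'(2) y by (simp add: mult_left_le)
  finally have nb: "nrm (lower_star \<Lambda>) (\<lambda>n. \<psi> n y) \<le> nrm F y" .
  have "0 \<le> nrm (lower_star \<Lambda>) (\<lambda>n. \<psi> n y)"
    using lower_star_functional[OF \<Lambda> b] normed.dual_nrm_nonneg[OF scalar_sequence_spaceD(1)[OF \<Lambda>]]
    by metis
  then show "norm (\<Sum>n. \<phi> n x * \<psi> n y) \<le> nrm E x * nrm F y"
    using lower_star_pairing(2)[OF \<Lambda> a b] mult_mono[OF na nb] x by simp
qed

theorem proposition3p4: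
  fixes E :: "('k::real_or_complex, 'a) nspace"
    and F :: "('k, 'b) nspace"
    and \<Lambda> :: "('k, nat \<Rightarrow> 'k) nspace"
    and X Y :: "('k, 'u) seq_rule"
    and \<iota>K :: "'k \<Rightarrow> 'u"
    and \<iota>E :: "('a \<Rightarrow> 'k) \<Rightarrow> 'u"
    and \<iota>F :: "('b \<Rightarrow> 'k) \<Rightarrow> 'u"
  assumes "banach_space E" and "banach_space F"
    and "scalar_sequence_space \<Lambda>"
    and "sequence_class X" and "linearly_stable X"
    and "sequence_class Y" and "linearly_stable Y"
    and "inj \<iota>K" and "inj_on \<iota>E (carrier (dual E))" and "inj_on \<iota>F (carrier (dual F))"
    and "embeds1 (class_at \<iota>K X scalar_space) \<Lambda>"
    and "embeds1 (class_at \<iota>K Y scalar_space) (lower_star \<Lambda>)"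
  shows "\<exists>\<alpha>. reasonable_crossnorm E F \<alpha> \<and>
    (\<forall>k x y. (\<forall>j<k. x j \<in> carrier E \<and> y j \<in> carrier F) \<longrightarrow>
       (\<forall>\<phi>\<in>unit_ball (class_at \<iota>E X (dual E)). \<forall>\<psi>\<in>unit_ball (class_at \<iota>F Y (dual F)).
          \<forall>j<k. summable (\<lambda>n. \<phi> n (x j) * \<psi> n (y j))) \<and>
       bdd_above (alpha_set (class_at \<iota>E X (dual E)) (class_at \<iota>F Y (dual F)) k x y) \<and>
       \<alpha> (tensor_sum E F k x y) =
         Sup (alpha_set (class_at \<iota>E X (dual E)) (class_at \<iota>F Y (dual F)) k x y))"
proof -
  let ?XE = "class_at \<iota>E X (dual E)" and ?YF = "class_at \<iota>F Y (dual F)"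
  have E: "normed E" and F: "normed F"
    using assms(1,2) by (simp_all add: banach_normed)
  note pairing = class_at_pairing[OF E F assms(3-12)]
  define \<B> where "\<B> = {\<lambda>x y. \<Sum>n. \<phi> n x * \<psi> n y | \<phi> \<psi>. \<phi> \<in> unit_ball ?XE \<and> \<psi> \<in> unit_ball ?YF}"
  have dual: "\<phi> n \<in> carrier (dual E)" "\<psi> n \<in> carrier (dual F)"
    if "\<phi> \<in> unit_ball ?XE" "\<psi> \<in> unit_ball ?YF" for \<phi> \<psi> n
    using that by (auto simp: unit_ball_def class_at_simps)
  have forms: "\<B> \<subseteq> bilinear_forms E F"
  proof
    fix B assume "B \<in> \<B>"
    then obtain \<phi> \<psi> where B: "B = (\<lambda>x y. \<Sum>n. \<phi> n x * \<psi> n y)"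
      and \<phi>\<psi>: "\<phi> \<in> unit_ball ?XE" "\<psi> \<in> unit_ball ?YF"
      unfolding \<B>_def by blast
    note summable = pairing(1)[OF \<phi>\<psi>]
    note D = dual_carrierD(2-4)[OF dual(1)[OF \<phi>\<psi>]] dual_carrierD(2-4)[OF dual(2)[OF \<phi>\<psi>]]
    show "B \<in> bilinear_forms E F"
      by (auto simp: bilinear_forms_def linear_map_def B D algebra_simps
          suminf_add[OF summable summable] suminf_mult[OF summable, symmetric])
  qed
  have contractive: "norm (B x y) \<le> nrm E x * nrm F y"
    if "B \<in> \<B>" "x \<in> carrier E" "y \<in> carrier F" for B x y
    using that pairing(2) unfolding \<B>_def by auto
  \<comment> \<open>One-term sequences turn the series into a single product.\<close>
  have products: "(\<lambda>x y. \<phi> x * \<psi> y) \<in> \<B>"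
    if "\<phi> \<in> unit_ball (dual E)" "\<psi> \<in> unit_ball (dual F)" for \<phi> \<psi>
  proof -
    have "single (dual E) \<phi> 0 \<in> unit_ball ?XE" "single (dual F) \<psi> 0 \<in> unit_ball ?YF"
      using that single_in_class_at[OF assms(4) normed.banach_dual[OF E] assms(9)]
        single_in_class_at[OF assms(6) normed.banach_dual[OF F] assms(10)]
      by (auto simp: unit_ball_def)
    moreover have "(\<lambda>x y. \<phi> x * \<psi> y)
        = (\<lambda>x y. \<Sum>n. single (dual E) \<phi> 0 n x * single (dual F) \<psi> 0 n y)"
    proof (intro ext)
      fix x y
      have "(\<lambda>n. single (dual E) \<phi> 0 n x * single (dual F) \<psi> 0 n y)
          = (\<lambda>n. if n = 0 then \<phi> x * \<psi> y else 0)"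
        by (auto simp: single_def)
      then show "\<phi> x * \<psi> y = (\<Sum>n. single (dual E) \<phi> 0 n x * single (dual F) \<psi> 0 n y)"
        using sums_single[of 0 "\<lambda>_. \<phi> x * \<psi> y"] by (simp add: sums_iff)
    qed
    ultimately show ?thesis
      unfolding \<B>_def by blast
  qed
  \<comment> \<open>Representations of a tensor enter the supremum only through the values of the forms in \<open>\<B>\<close>.\<close>
  have alpha_set: "alpha_set ?XE ?YF k x y = (\<lambda>B. norm (tensor_sum E F k x y B)) ` \<B>" for k x y
  proof -
    have eval: "tensor_sum E F k x y (\<lambda>x y. \<Sum>n. \<phi> n x * \<psi> n y) = (\<Sum>j<k. \<Sum>n. \<phi> n (x j) * \<psi> n (y j))"
      if "\<phi> \<in> unit_ball ?XE" "\<psi> \<in> unit_ball ?YF" for \<phi> \<psi>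
      by (rule tensor_sum_eval(1)) (use that forms in \<open>unfold \<B>_def, blast\<close>)
    show ?thesis
    proof (intro equalityI subsetI)
      fix r assume "r \<in> alpha_set ?XE ?YF k x y"
      then obtain \<phi> \<psi> where r: "r = norm (\<Sum>j<k. \<Sum>n. \<phi> n (x j) * \<psi> n (y j))"
        and \<phi>\<psi>: "\<phi> \<in> unit_ball ?XE" "\<psi> \<in> unit_ball ?YF"
        unfolding alpha_set_def by blast
      have "(\<lambda>x y. \<Sum>n. \<phi> n x * \<psi> n y) \<in> \<B>"
        unfolding \<B>_def using \<phi>\<psi> by blast
      then show "r \<in> (\<lambda>B. norm (tensor_sum E F k x y B)) ` \<B>"
        by (rule rev_image_eqI) (simp only: r eval[OF \<phi>\<psi>])
    next
      fix r assume "r \<in> (\<lambda>B. norm (tensor_sum E F k x y B)) ` \<B>"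
      then obtain \<phi> \<psi> where r: "r = norm (tensor_sum E F k x y (\<lambda>x y. \<Sum>n. \<phi> n x * \<psi> n y))"
        and \<phi>\<psi>: "\<phi> \<in> unit_ball ?XE" "\<psi> \<in> unit_ball ?YF"
        unfolding \<B>_def by blast
      show "r \<in> alpha_set ?XE ?YF k x y"
        unfolding r eval[OF \<phi>\<psi>] alpha_set_def using \<phi>\<psi> by blast
    qed
  qed
  note crossnorm = reasonable_crossnorm_sup_over_forms[OF E F forms]
  show ?thesis
  proof (intro exI[of _ "sup_over_forms \<B>"] conjI allI impI)
    show "reasonable_crossnorm E F (sup_over_forms \<B>)"
      by (rule crossnorm(1)) (fact contractive products)+
    fix k and x :: "nat \<Rightarrow> 'a" and y :: "nat \<Rightarrow> 'b"
    assume xy: "\<forall>j<k. x j \<in> carrier E \<and> y j \<in> carrier F"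
    show "\<forall>\<phi>\<in>unit_ball ?XE. \<forall>\<psi>\<in>unit_ball ?YF. \<forall>j<k. summable (\<lambda>n. \<phi> n (x j) * \<psi> n (y j))"
      using xy pairing(1) by blast
    show "bdd_above (alpha_set ?XE ?YF k x y)"
      unfolding alpha_set by (rule crossnorm(2)) (fact contractive products xy)+
    show "sup_over_forms \<B> (tensor_sum E F k x y) = Sup (alpha_set ?XE ?YF k x y)"
      by (simp add: alpha_set sup_over_forms_def)
  qed
qed

end
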